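(* For every two-qubit unitary $U$, with quasiprobability extent $\gamma=\gamma(U)$ and maximum product-input concurrence $C_{\max}=C_{\max}(U)\in[0,1]$, $$1+2C_{\max}\;\le\;\gamma\;\le\;7.$$ Both bounds are realised for every fixed value of $C_{\max}\in[0,1]$: the controlled family $(\theta,0,0)$ attains the lower boundary, and the iSWAP--SWAP family $(\pi/4,\pi/4,\theta)$ attains the upper boundary.
   Context: Cartan form. Every two-qubit unitary $U\in U(4)$ can be written $U=(V_1\otimes V_2)\,U_{\mathrm d}\,(V_3\otimes V_4)$ with single-qubit unitaries $V_j$ and $U_{\mathrm d}=U_{\mathrm d}(\theta_1,\theta_2,\theta_3)=\exp[\mathrm i(\theta_1X\otimes X+\theta_2Y\otimes Y+\theta_3Z\otimes Z)]$, where $X,Y,Z$ are the Pauli matrices and $|\theta_3|\le\theta_2\le\theta_1\le\pi/4$. A "family" $(\theta_1(\theta),\theta_2(\theta),\theta_3(\theta))$ means the gates $U_{\mathrm d}(\theta_1(\theta),\theta_2(\theta),\theta_3(\theta))$ for $0\le\theta\le\pi/4$. A family "attains" a boundary if for each value $v\in[0,1]$ some member of the family has $C_{\max}=v$ and $\gamma$ equal to the boundary value at $v$. Quasiprobability extent. Write $U_{\mathrm d}=\sum_{j=0}^3u_j\,\sigma_j\otimes\sigma_j$ with $\sigma_0=\mathbb I,\sigma_1=X,\sigma_2=Y,\sigma_3=Z$, and $p_j=|u_j|^2$, so $\sum_jp_j=1$. (Intrinsically, the operator-Schmidt singular values of $U$ with respect to Hilbert--Schmidt-orthonormal local operator bases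 are $2\sqrt{p_j}$.) $\gamma(U)$ is the optimal gate-cutting (quasiprobability decomposition) cost of $U$; for two-qubit unitaries it is given by the known formula, taken here as its definition, $\gamma(U)=2\big(\sum_{j=0}^3\sqrt{p_j}\big)^2-1$. Maximum product-input concurrence. $C_{\max}(U)=\max_{|\psi_A\rangle,|\psi_B\rangle}C(U|\psi_A\rangle|\psi_B\rangle)$ over normalised single-qubit states, where for a normalised two-qubit pure state with Schmidt coefficients $s_1,s_2\ge0$ ($s_1^2+s_2^2=1$) the concurrence is $C=2s_1s_2$. In Cartan parameters this is known to equal: $\sin[2(\theta_1+\theta_2)]$ if $\theta_1+\theta_2<\pi/4$; $1$ if $\theta_1+\theta_2\ge\pi/4$ and $\theta_2+|\theta_3|\le\pi/4$; $\sin[2(\theta_2+|\theta_3|)]$ if $\theta_2+|\theta_3|>\pi/4$. *)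

theory Defs
  imports "HOL-Analysis.Analysis"
begin

type_synonym qubit = "complex ^ 2"
type_synonym two_qubit = "complex ^ (2 \<times> 2)"
type_synonym gate1 = "complex ^ 2 ^ 2"
type_synonym gate2 = "complex ^ (2 \<times> 2) ^ (2 \<times> 2)"

definition adjoint_mat :: "complex ^ 'n ^ 'm \<Rightarrow> complex ^ 'm ^ 'n" where
  "adjoint_mat A = (\<chi> i j. cnj (A $ j $ i))"

definition unitary_mat :: "complex ^ 'n::finite ^ 'n \<Rightarrow> bool" where
  "unitary_mat A \<longleftrightarrow> adjoint_mat A ** A = mat 1 \<and> A ** adjoint_mat A = mat 1"

text \<open>The operation \<open>*s\<close> of the library multiplies a matrix row by row with a vector;
  scaling by a complex number therefore needs its own definition.\<close>

definition cscale :: "complex \<Rightarrow> complex ^ 'n ^ 'm \<Rightarrow> complex ^ 'n ^ 'm" where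
  "cscale c A = (\<chi> i j. c * A $ i $ j)"

definition kron :: "gate1 \<Rightarrow> gate1 \<Rightarrow> gate2"  (infixr "\<otimes>\<^sub>m" 75) where
  "A \<otimes>\<^sub>m B = (\<chi> i j. A $ fst i $ fst j * B $ snd i $ snd j)"

definition kron_vec :: "qubit \<Rightarrow> qubit \<Rightarrow> two_qubit"  (infixr "\<otimes>\<^sub>v" 75) where
  "a \<otimes>\<^sub>v b = (\<chi> i. a $ fst i * b $ snd i)"

text \<open>The library has no normed algebra of square matrices under \<open>**\<close> (so \<open>exp\<close> does not
  apply); the exponential is the usual power series, convergent entrywise.\<close>

definition mat_exp :: "complex ^ 'n::finite ^ 'n \<Rightarrow> complex ^ 'n ^ 'n" where
  "mat_exp A = (\<Sum>n. (1 / fact n) *\<^sub>R (((**) A ^^ n) (mat 1)))"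

text \<open>\<open>pauli 0, \<dots>, pauli 3\<close> are the identity, $X$, $Y$ and $Z$.\<close>

definition pauli :: "nat \<Rightarrow> gate1" where
  "pauli j =
    [mat 1,
     vector [vector [0, 1], vector [1, 0]],
     vector [vector [0, - \<i>], vector [\<i>, 0]],
     vector [vector [1, 0], vector [0, - 1]]] ! j"

definition U_d :: "real \<Rightarrow> real \<Rightarrow> real \<Rightarrow> gate2" where
  "U_d \<theta>1 \<theta>2 \<theta>3 = mat_exp (cscale \<i>
     (\<theta>1 *\<^sub>R (pauli 1 \<otimes>\<^sub>m pauli 1) + \<theta>2 *\<^sub>R (pauli 2 \<otimes>\<^sub>m pauli 2) + \<theta>3 *\<^sub>R (pauli 3 \<otimes>\<^sub>m pauli 3)))"

definition cartan_form :: "gate2 \<Rightarrow> real \<Rightarrow> real \<Rightarrow> real \<Rightarrow> bool" where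
  "cartan_form U \<theta>1 \<theta>2 \<theta>3 \<longleftrightarrow>
     \<bar>\<theta>3\<bar> \<le> \<theta>2 \<and> \<theta>2 \<le> \<theta>1 \<and> \<theta>1 \<le> pi / 4 \<and>
     (\<exists>V1 V2 V3 V4. unitary_mat V1 \<and> unitary_mat V2 \<and> unitary_mat V3 \<and> unitary_mat V4 \<and>
        U = (V1 \<otimes>\<^sub>m V2) ** U_d \<theta>1 \<theta>2 \<theta>3 ** (V3 \<otimes>\<^sub>m V4))"

text \<open>\<open>THE\<close> commits to the value being the same for every Cartan form of \<open>U\<close>.\<close>

definition extent :: "gate2 \<Rightarrow> real"  ("\<gamma>") where
  "\<gamma> U = (THE g. \<exists>\<theta>1 \<theta>2 \<theta>3 u p. cartan_form U \<theta>1 \<theta>2 \<theta>3 \<and>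
     U_d \<theta>1 \<theta>2 \<theta>3 = (\<Sum>j\<le>3. cscale (u j) (pauli j \<otimes>\<^sub>m pauli j)) \<and>
     (\<forall>j::nat. p j = (cmod (u j))\<^sup>2) \<and>
     g = 2 * (\<Sum>j\<le>3. sqrt (p j))\<^sup>2 - 1)"

definition orthonormal_pair :: "qubit \<Rightarrow> qubit \<Rightarrow> bool" where
  "orthonormal_pair a b \<longleftrightarrow> norm a = 1 \<and> norm b = 1 \<and> (\<Sum>i\<in>UNIV. cnj (a $ i) * b $ i) = 0"

text \<open>Meant for \<open>norm \<psi> = 1\<close>; the value is read off any Schmidt decomposition.\<close>

definition concurrence :: "two_qubit \<Rightarrow> real" where
  "concurrence \<psi> = (THE c. \<exists>s1 s2 a1 a2 b1 b2.
     orthonormal_pair a1 a2 \<and> orthonormal_pair b1 b2 \<and>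
     0 \<le> s1 \<and> 0 \<le> s2 \<and> s1\<^sup>2 + s2\<^sup>2 = 1 \<and>
     \<psi> = s1 *\<^sub>R (a1 \<otimes>\<^sub>v b1) + s2 *\<^sub>R (a2 \<otimes>\<^sub>v b2) \<and>
     c = 2 * s1 * s2)"

text \<open>The maximum over an infinite set, so \<open>GREATEST\<close> rather than \<open>Max\<close>; unlike
  \<open>Sup\<close> it also commits to the maximum being attained.\<close>

definition C_max :: "gate2 \<Rightarrow> real" where
  "C_max U = (GREATEST c. \<exists>a b. norm a = 1 \<and> norm b = 1 \<and> c = concurrence (U *v (a \<otimes>\<^sub>v b)))"

definition attains :: "(real \<Rightarrow> gate2) \<Rightarrow> (real \<Rightarrow> real) \<Rightarrow> bool" where
  "attains F \<beta> \<longleftrightarrow>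
     (\<forall>v\<in>{0..1}. \<exists>\<theta>\<in>{0..pi / 4}. C_max (F \<theta>) = v \<and> \<gamma> (F \<theta>) = \<beta> v)"

end

theory Submission
  imports Defs
begin

text \<open>Write $U = (V_1 \otimes V_2)\,(\sum_j u_j\, \sigma_j \otimes \sigma_j)\,(V_3 \otimes V_4)$. The concurrence of a
  state is twice the modulus of the determinant of its coefficient matrix. For the image of a
  product state, Cauchy--Binet expands this determinant into terms
  $u_j u_k\, (x_j \wedge x_k)(y_j \wedge y_k)$ over \<open>j < k\<close> with unit vectors \<open>x j\<close>, \<open>y j\<close>, so that
  $C_{\max} \le (\sum_j |u_j|)^2 - \sum_j |u_j|^2 = (\gamma - 1) / 2$. The upper bound is
  Cauchy--Schwarz.

  That every unitary has a Cartan form is seen in the magic basis, where local unitaries are real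
  orthogonal: for unitary \<open>N\<close> the real and imaginary parts of the symmetric unitary $N^T N$ are
  commuting real symmetric matrices, a common orthonormal eigenbasis is mapped by \<open>N\<close> to a
  real orthonormal basis up to phases, and real orthonormal bases come from local unitaries
  because real vectors are quaternions.\<close>

section \<open>Matrices\<close>

text \<open>The definitions by description oblige the proof to show that their values exist. For
  \<open>\<gamma>\<close> some Cartan form must exist and all of them must give one value; the
  angles are not compared, only the sum of the \<open>cmod (u j)\<close>, which local unitaries
  preserve. For \<open>C_max\<close> the maximum is attained because a product of two unit spheres
  is compact.

  Product terms have determinant zero, so only mixed pairs of Pauli terms survive, and
  \<open>\<gamma> - 1\<close> is four times the sum of \<open>cmod (u j) * cmod (u k)\<close> over
  these pairs. Along the controlled family at most one pair is nonzero; along the iSWAP--SWAP family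
  all four moduli equal 1/2.

  The obstacle in the existence proof is orientation: a left-handed real basis comes from local
  unitaries only up to signs. Each basis vector therefore carries a sign, which ends up in the
  diagonal phases. These four phases split into three angles and a global phase, which moves into a
  local factor. The angles are then arbitrary reals, brought into the required region by shifts by
  pi / 2, permutations and paired sign changes.\<close>

lemma sum_UNIV_2x2:
  fixes f :: "2 \<times> 2 \<Rightarrow> 'a::comm_monoid_add"
  shows "(\<Sum>k\<in>UNIV. f k) = f (1,1) + f (1,2) + f (2,1) + f (2,2)"
proof -
  have "(\<Sum>k\<in>UNIV. f k) = (\<Sum>i\<in>UNIV. \<Sum>j\<in>UNIV. f (i, j))"
    by (simp add: sum.cartesian_product)
  then show ?thesis by (simp add: sum_2 add.assoc)
qed

lemma forall_2x2: "(\<forall>k::2 \<times> 2. P k) \<longleftrightarrow> P (1,1) \<and> P (1,2) \<and> P (2,1) \<and> P (2,2)"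
  by (auto simp: forall_2)

lemma sum_atMost_3: "(\<Sum>j\<le>3::nat. f j) = f 0 + f 1 + f 2 + (f 3 :: 'a::comm_monoid_add)"
  by (simp add: numeral_eq_Suc add.assoc)

lemmas vec2_eq_iff = vec_eq_iff[where 'b = 2, unfolded forall_2]
lemmas vec22_eq_iff = vec_eq_iff[where 'b = "2 \<times> 2", unfolded forall_2x2]

lemma adjoint_mat_nth [simp]: "adjoint_mat A $ i $ j = cnj (A $ j $ i)"
  by (simp add: adjoint_mat_def)

lemma cscale_nth [simp]: "cscale c A $ i $ j = c * A $ i $ j"
  by (simp add: cscale_def)

lemma kron_nth [simp]: "(A \<otimes>\<^sub>m B) $ i $ j = A $ fst i $ fst j * B $ snd i $ snd j"
  by (simp add: kron_def)

lemma kron_vec_nth [simp]: "(a \<otimes>\<^sub>v b) $ i = a $ fst i * b $ snd i"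
  by (simp add: kron_vec_def)

lemma pauli_simps:
  "pauli 0 = mat 1"
  "pauli 1 = vector [vector [0, 1], vector [1, 0]]"
  "pauli (Suc 0) = vector [vector [0, 1], vector [1, 0]]"
  "pauli 2 = vector [vector [0, - \<i>], vector [\<i>, 0]]"
  "pauli 3 = vector [vector [1, 0], vector [0, - 1]]"
  by (simp_all add: pauli_def numeral_eq_Suc)

lemma pauli_nth [simp]:
  "pauli 0 $ i $ j = (if i = j then 1 else 0)"
  "pauli 1 $ 1 $ 1 = 0" "pauli 1 $ 1 $ 2 = 1" "pauli 1 $ 2 $ 1 = 1" "pauli 1 $ 2 $ 2 = 0"
  "pauli (Suc 0) $ 1 $ 1 = 0" "pauli (Suc 0) $ 1 $ 2 = 1" "pauli (Suc 0) $ 2 $ 1 = 1" "pauli (Suc 0) $ 2 $ 2 = 0"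
  "pauli 2 $ 1 $ 1 = 0" "pauli 2 $ 1 $ 2 = - \<i>" "pauli 2 $ 2 $ 1 = \<i>" "pauli 2 $ 2 $ 2 = 0"
  "pauli 3 $ 1 $ 1 = 1" "pauli 3 $ 1 $ 2 = 0" "pauli 3 $ 2 $ 1 = 0" "pauli 3 $ 2 $ 2 = -1"
  by (simp_all add: pauli_simps mat_def vector_2)

lemma adjoint_mat_mult: "adjoint_mat (A ** B) = adjoint_mat B ** adjoint_mat A"
  by (simp add: vec_eq_iff matrix_matrix_mult_def mult.commute)

lemma adjoint_mat_adjoint_mat [simp]: "adjoint_mat (adjoint_mat A) = A"
  by (simp add: vec_eq_iff)

lemma adjoint_mat_mat_1 [simp]: "adjoint_mat (mat 1) = mat 1"
  by (auto simp: vec_eq_iff mat_def)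

lemma adjoint_mat_kron: "adjoint_mat (A \<otimes>\<^sub>m B) = adjoint_mat A \<otimes>\<^sub>m adjoint_mat B"
  by (simp add: vec_eq_iff)

lemma kron_mult: "(A \<otimes>\<^sub>m B) ** (C \<otimes>\<^sub>m D) = (A ** C) \<otimes>\<^sub>m (B ** D)"
  by (simp add: vec_eq_iff matrix_matrix_mult_def sum_UNIV_2x2 sum_2 algebra_simps)

lemma kron_mult_vec: "(A \<otimes>\<^sub>m B) *v (a \<otimes>\<^sub>v b) = (A *v a) \<otimes>\<^sub>v (B *v b)"
  by (simp add: vec_eq_iff matrix_vector_mult_def sum_UNIV_2x2 sum_2 algebra_simps)

lemma kron_mat_1: "mat 1 \<otimes>\<^sub>m mat 1 = mat 1"
  by (auto simp: vec_eq_iff mat_def)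

lemma cscale_cscale: "cscale c (cscale d A) = cscale (c * d) A"
  by (simp add: vec_eq_iff)

lemma cscale_mult_left: "cscale c A ** B = cscale c (A ** B)"
  by (simp add: vec_eq_iff matrix_matrix_mult_def sum_distrib_left mult.assoc)

lemma cscale_mult_right: "A ** cscale c B = cscale c (A ** B)"
  by (simp add: vec_eq_iff matrix_matrix_mult_def sum_distrib_left mult.left_commute)

lemma unitary_matD:
  assumes "unitary_mat A"
  shows "adjoint_mat A ** A = mat 1" "A ** adjoint_mat A = mat 1"
  using assms by (auto simp: unitary_mat_def)

lemma unitary_mat_mat_1: "unitary_mat (mat 1)"
  by (simp add: unitary_mat_def)

lemma unitary_mat_adjoint: "unitary_mat A \<Longrightarrow> unitary_mat (adjoint_mat A)"
  by (simp add: unitary_mat_def)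

lemma unitary_mat_mult:
  assumes "unitary_mat A" "unitary_mat B"
  shows "unitary_mat (A ** B)"
proof -
  have "adjoint_mat (A ** B) ** (A ** B) = adjoint_mat B ** (adjoint_mat A ** A) ** B"
    by (simp add: adjoint_mat_mult matrix_mul_assoc)
  moreover have "(A ** B) ** adjoint_mat (A ** B) = A ** (B ** adjoint_mat B) ** adjoint_mat A"
    by (simp add: adjoint_mat_mult matrix_mul_assoc)
  ultimately show ?thesis
    using assms by (simp add: unitary_mat_def)
qed

lemma unitary_mat_kron: "unitary_mat A \<Longrightarrow> unitary_mat B \<Longrightarrow> unitary_mat (A \<otimes>\<^sub>m B)"
  by (simp add: unitary_mat_def adjoint_mat_kron kron_mult kron_mat_1)

lemma unitary_mat_cscale:
  assumes "cmod c = 1" "unitary_mat A"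
  shows "unitary_mat (cscale c A)"
proof -
  have "adjoint_mat (cscale c A) = cscale (cnj c) (adjoint_mat A)"
    by (simp add: vec_eq_iff)
  moreover have "c * cnj c = 1"
    using assms(1) by (simp add: complex_norm_square [symmetric])
  ultimately show ?thesis
    using assms(2) by (simp add: unitary_mat_def cscale_mult_left cscale_mult_right cscale_cscale
        mult.commute) (simp add: vec_eq_iff)
qed

lemma unitary_mat_pauli: "j \<le> 3 \<Longrightarrow> unitary_mat (pauli j)"
proof -
  assume "j \<le> 3"
  then consider "j = 0" | "j = 1" | "j = 2" | "j = 3" by linarith
  then show ?thesis
    by cases (simp_all add: unitary_mat_def vec2_eq_iff matrix_matrix_mult_def sum_2 mat_def)
qed

lemma norm_vec_power2: "(norm (x :: complex ^ 'n::finite))\<^sup>2 = (\<Sum>i\<in>UNIV. (cmod (x $ i))\<^sup>2)"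
  by (simp add: norm_vec_def L2_set_def sum_nonneg)

lemma norm_vec_power2': "of_real ((norm (x :: complex ^ 'n::finite))\<^sup>2) = (\<Sum>i\<in>UNIV. cnj (x $ i) * x $ i)"
  unfolding norm_vec_power2 of_real_sum
  by (intro sum.cong refl) (simp only: complex_norm_square mult.commute)

lemma cinner_adjoint_mat:
  "(\<Sum>i\<in>UNIV. cnj (y $ i) * (A *v x) $ i) = (\<Sum>i\<in>UNIV. cnj ((adjoint_mat A *v y) $ i) * x $ i)"
proof -
  have "(\<Sum>i\<in>UNIV. cnj (y $ i) * (A *v x) $ i) = (\<Sum>i\<in>UNIV. \<Sum>j\<in>UNIV. cnj (y $ i) * (A $ i $ j * x $ j))"
    by (simp add: matrix_vector_mult_def sum_distrib_left)
  also have "\<dots> = (\<Sum>j\<in>UNIV. \<Sum>i\<in>UNIV. cnj (y $ i) * (A $ i $ j * x $ j))"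
    by (rule sum.swap)
  also have "\<dots> = (\<Sum>i\<in>UNIV. cnj ((adjoint_mat A *v y) $ i) * x $ i)"
    by (simp add: matrix_vector_mult_def sum_distrib_right sum_distrib_left algebra_simps)
  finally show ?thesis .
qed

lemma unitary_mat_cinner:
  assumes "unitary_mat A"
  shows "(\<Sum>i\<in>UNIV. cnj ((A *v y) $ i) * (A *v x) $ i) = (\<Sum>i\<in>UNIV. cnj (y $ i) * x $ i)"
  using assms by (simp add: cinner_adjoint_mat matrix_vector_mul_assoc unitary_mat_def)

lemma unitary_mat_norm:
  assumes "unitary_mat A"
  shows "norm (A *v x) = norm x"
proof -
  have "complex_of_real ((norm (A *v x))\<^sup>2) = of_real ((norm x)\<^sup>2)"
    unfolding norm_vec_power2' by (rule unitary_mat_cinner [OF assms])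
  then have "(norm (A *v x))\<^sup>2 = (norm x)\<^sup>2" by (simp only: of_real_eq_iff)
  then show ?thesis by simp
qed

section \<open>Commuting self-adjoint maps\<close>

text \<open>A maximiser \<open>x\<close> of the Rayleigh quotient on the unit sphere of
  \<open>S\<close> is an eigenvector: the quadratic form \<open>B\<close> of \<open>a - f\<close> is
  nonnegative on \<open>S\<close> and vanishes at \<open>x\<close>, while moving from
  \<open>x\<close> along the residual \<open>h\<close> changes it at first order by
  \<open>- 2 * t * (h \<bullet> h)\<close>.\<close>

lemma selfadjoint_eigenvector:
  fixes f :: "'a::euclidean_space \<Rightarrow> 'a"
  assumes f: "linear f" and sym: "\<And>x y. f x \<bullet> y = x \<bullet> f y"
    and S: "subspace S" "f ` S \<subseteq> S" and z: "z \<in> S" "z \<noteq> 0"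
  obtains x a where "x \<in> S" "norm x = 1" "f x = a *\<^sub>R x"
proof -
  have "compact (S \<inter> sphere 0 1)"
    by (rule closed_Int_compact [OF closed_subspace [OF S(1)] compact_sphere])
  moreover have "z /\<^sub>R norm z \<in> S \<inter> sphere 0 1"
    using z S(1) by (simp add: subspace_scale)
  moreover have "continuous_on (S \<inter> sphere 0 1) (\<lambda>x. f x \<bullet> x)"
    by (intro continuous_on_inner linear_continuous_on continuous_on_id) (use f in \<open>simp add: linear_conv_bounded_linear\<close>)
  ultimately have "\<exists>x\<in>S \<inter> sphere 0 1. \<forall>y\<in>S \<inter> sphere 0 1. f y \<bullet> y \<le> f x \<bullet> x"
    by (intro continuous_attains_sup) blast+
  then obtain x where x: "x \<in> S" "norm x = 1"
    and max: "\<And>y. y \<in> S \<Longrightarrow> norm y = 1 \<Longrightarrow> f y \<bullet> y \<le> f x \<bullet> x"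
    by auto
  define a where "a = f x \<bullet> x"
  define B where "B y = a * (y \<bullet> y) - f y \<bullet> y" for y
  have B: "0 \<le> B y" if "y \<in> S" for y
  proof (cases "y = 0")
    case True
    then show ?thesis by (simp add: B_def)
  next
    case False
    have "f (y /\<^sub>R norm y) \<bullet> (y /\<^sub>R norm y) \<le> a"
      unfolding a_def by (rule max) (use False that S(1) in \<open>auto simp: subspace_scale\<close>)
    then have "(f y \<bullet> y) / (norm y)\<^sup>2 \<le> a"
      by (simp add: linear_scale [OF f] power2_eq_square field_simps)
    then show ?thesis
      using False by (simp add: B_def divide_simps dot_square_norm)
  qed
  define h where "h = f x - a *\<^sub>R x"
  have h: "h \<in> S"
    using x S by (auto simp: h_def intro!: subspace_diff subspace_scale)
  have Bt: "B (x + t *\<^sub>R h) = t\<^sup>2 * B h - 2 * t * (h \<bullet> h)" for t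
  proof -
    have "a * (x \<bullet> h) - f x \<bullet> h = - (h \<bullet> h)" "f h \<bullet> x = f x \<bullet> h"
      using sym[of h x] by (simp_all add: h_def algebra_simps inner_commute)
    moreover have "x \<bullet> x = 1" using x(2) by (simp add: dot_square_norm)
    moreover have "B (x + t *\<^sub>R h) = a * (x \<bullet> x + 2 * t * (x \<bullet> h) + t\<^sup>2 * (h \<bullet> h))
        - (a + t * (f x \<bullet> h) + t * (f h \<bullet> x) + t\<^sup>2 * (f h \<bullet> h))"
      unfolding B_def linear_add [OF f] linear_scale [OF f] a_def
      by (simp add: inner_add_left inner_add_right inner_commute[of h x] power2_eq_square algebra_simps)
    ultimately have "B (x + t *\<^sub>R h) = 2 * t * (a * (x \<bullet> h) - f x \<bullet> h) + t\<^sup>2 * (a * (h \<bullet> h) - f h \<bullet> h)"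
      by (simp add: algebra_simps)
    then show ?thesis
      using \<open>a * (x \<bullet> h) - f x \<bullet> h = - (h \<bullet> h)\<close> by (simp add: B_def)
  qed
  have "h \<bullet> h = 0"
  proof (rule ccontr)
    assume "h \<bullet> h \<noteq> 0"
    then have H: "h \<bullet> h > 0" by (metis inner_ge_zero less_eq_real_def)
    \<comment> \<open>Small enough for the linear term to beat the quadratic one, as
      \<open>B h / (B h + 1) \<le> 1\<close>; the summand 1 keeps the denominator positive when
      \<open>B h = 0\<close>.\<close>
    define t where "t = (h \<bullet> h) / (B h + 1)"
    have t: "t > 0" using H B[OF h] by (simp add: t_def)
    have "0 \<le> B (x + t *\<^sub>R h)"
      by (rule B) (use x h S in \<open>auto intro: subspace_add subspace_scale\<close>)
    then have "0 \<le> t * (t * B h - 2 * (h \<bullet> h))"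
      by (simp add: Bt power2_eq_square algebra_simps)
    then have "2 * (h \<bullet> h) \<le> t * B h" using t by (simp add: zero_le_mult_iff)
    also have "t * B h \<le> h \<bullet> h" using H B[OF h] by (simp add: t_def field_simps)
    finally show False using H by simp
  qed
  then have "f x = a *\<^sub>R x" by (simp add: h_def)
  with x that show ?thesis by blast
qed

text \<open>An eigenspace of \<open>f\<close> inside \<open>S\<close> is invariant under
  \<open>g\<close> because the maps commute, so \<open>g\<close> has an eigenvector in it.\<close>

lemma commuting_selfadjoint_eigenvector:
  fixes f g :: "'a::euclidean_space \<Rightarrow> 'a"
  assumes f: "linear f" "\<And>x y. f x \<bullet> y = x \<bullet> f y"
    and g: "linear g" "\<And>x y. g x \<bullet> y = x \<bullet> g y"
    and fg: "\<And>x. f (g x) = g (f x)"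
    and S: "subspace S" "f ` S \<subseteq> S" "g ` S \<subseteq> S" and z: "z \<in> S" "z \<noteq> 0"
  obtains x a b where "x \<in> S" "norm x = 1" "f x = a *\<^sub>R x" "g x = b *\<^sub>R x"
proof -
  obtain x a where x: "x \<in> S" "norm x = 1" "f x = a *\<^sub>R x"
    using selfadjoint_eigenvector [OF f S(1,2) z] by blast
  let ?T = "{y \<in> S. f y = a *\<^sub>R y}"
  have "subspace ?T"
    using S(1) f(1) by (auto simp: subspace_def linear_add linear_scale linear_0 algebra_simps)
  moreover have "g ` ?T \<subseteq> ?T"
    using S(3) by (auto simp: fg linear_scale [OF g(1)])
  moreover have "x \<in> ?T" "x \<noteq> 0" using x by auto
  ultimately obtain y b where "y \<in> ?T" "norm y = 1" "g y = b *\<^sub>R y"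
    using selfadjoint_eigenvector [OF g] by blast
  then show ?thesis using that by blast
qed

text \<open>Common eigenvectors are collected one at a time: by self-adjointness the orthogonal
  complement of those already found is invariant under both maps. The resulting set has as many
  elements as the index type, and a bijection labels it.\<close>

lemma commuting_selfadjoint_eigenbasis:
  fixes f g :: "real ^ 'n \<Rightarrow> real ^ 'n"
  assumes f: "linear f" "\<And>x y. f x \<bullet> y = x \<bullet> f y"
    and g: "linear g" "\<And>x y. g x \<bullet> y = x \<bullet> g y"
    and fg: "\<And>x. f (g x) = g (f x)"
  obtains e :: "'n \<Rightarrow> real ^ 'n" and a b
  where "\<And>i j. e i \<bullet> e j = (if i = j then 1 else 0)"
    and "\<And>i. f (e i) = a i *\<^sub>R e i" "\<And>i. g (e i) = b i *\<^sub>R e i"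
proof -
  let ?eig = "\<lambda>x. norm x = 1 \<and> (\<exists>a. f x = a *\<^sub>R x) \<and> (\<exists>b. g x = b *\<^sub>R x)"
  have "\<exists>B. finite B \<and> card B = n \<and> pairwise orthogonal B \<and> (\<forall>x\<in>B. ?eig x)"
    if "n \<le> CARD('n)" for n
    using that
  proof (induction n)
    case 0
    then show ?case by (intro exI[of _ "{}"]) auto
  next
    case (Suc n)
    then obtain B where B: "finite B" "card B = n" "pairwise orthogonal B" "\<forall>x\<in>B. ?eig x" by auto
    have "dim B < DIM(real ^ 'n)"
      using dim_le_card' [OF B(1)] B(2) Suc.prems by simp
    then obtain z where z: "z \<noteq> 0" "\<And>y. y \<in> span B \<Longrightarrow> orthogonal z y"
      using orthogonal_to_subspace_exists by blast
    let ?S = "{x. \<forall>b\<in>B. x \<bullet> b = 0}"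
    have "subspace ?S" by (auto simp: subspace_def inner_add_left)
    moreover have "f ` ?S \<subseteq> ?S"
    proof clarify
      fix x c assume "\<forall>b\<in>B. x \<bullet> b = 0" "c \<in> B"
      moreover obtain a where "f c = a *\<^sub>R c" using B(4) \<open>c \<in> B\<close> by blast
      ultimately show "f x \<bullet> c = 0" by (simp add: f(2))
    qed
    moreover have "g ` ?S \<subseteq> ?S"
    proof clarify
      fix x c assume "\<forall>b\<in>B. x \<bullet> b = 0" "c \<in> B"
      moreover obtain a where "g c = a *\<^sub>R c" using B(4) \<open>c \<in> B\<close> by blast
      ultimately show "g x \<bullet> c = 0" by (simp add: g(2))
    qed
    moreover have "z \<in> ?S" using z(2) by (auto simp: orthogonal_def span_base)
    ultimately obtain x a b where x: "x \<in> ?S" "norm x = 1" "f x = a *\<^sub>R x" "g x = b *\<^sub>R x"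
      by (rule commuting_selfadjoint_eigenvector [OF f g fg _ _ _ _ z(1), of ?S])
    have "x \<notin> B" using x(1,2) by (auto simp: dot_square_norm)
    then have "card (insert x B) = Suc n" using B by simp
    moreover have "pairwise orthogonal (insert x B)"
      using B(3) x(1) by (auto simp: pairwise_insert orthogonal_def inner_commute)
    ultimately show ?case
      using B x by (intro exI[of _ "insert x B"]) auto
  qed
  then obtain B where B: "finite B" "card B = CARD('n)" "pairwise orthogonal B" "\<forall>x\<in>B. ?eig x"
    by blast
  obtain e where e: "bij_betw e (UNIV :: 'n set) B"
    using B finite_same_card_bij[of "UNIV :: 'n set" B] by auto
  have eB: "e i \<in> B" for i using e by (auto simp: bij_betw_def)
  have "\<forall>i. \<exists>a. f (e i) = a *\<^sub>R e i" "\<forall>i. \<exists>b. g (e i) = b *\<^sub>R e i"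
    using eB B(4) by blast+
  then obtain a b where "\<forall>i. f (e i) = a i *\<^sub>R e i" "\<forall>i. g (e i) = b i *\<^sub>R e i"
    using choice by meson
  moreover have "e i \<bullet> e j = (if i = j then 1 else 0)" for i j
  proof (cases "i = j")
    case True
    then show ?thesis using eB B(4) by (simp add: dot_square_norm)
  next
    case False
    then have "e i \<noteq> e j" using e by (auto simp: bij_betw_def inj_on_def)
    then show ?thesis using False eB B(3) by (auto simp: pairwise_def orthogonal_def)
  qed
  ultimately show ?thesis using that by blast
qed

section \<open>Concurrence\<close>

definition wedge :: "qubit \<Rightarrow> qubit \<Rightarrow> complex" where
  "wedge x y = x $ 1 * y $ 2 - x $ 2 * y $ 1"

definition det_vec :: "two_qubit \<Rightarrow> complex" where
  "det_vec \<psi> = \<psi> $ (1,1) * \<psi> $ (2,2) - \<psi> $ (1,2) * \<psi> $ (2,1)"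

text \<open>The antiunitary spin flip: for a unit vector \<open>x\<close> the matrix with columns
  \<open>x\<close> and \<open>perp x\<close> lies in SU(2).\<close>

definition perp :: "qubit \<Rightarrow> qubit" where
  "perp x = vector [- cnj (x $ 2), cnj (x $ 1)]"

lemma perp_nth [simp]: "perp x $ 1 = - cnj (x $ 2)" "perp x $ 2 = cnj (x $ 1)"
  by (simp_all add: perp_def)

lemma scaleR_nth: "(r *\<^sub>R (x :: complex ^ 'n)) $ i = of_real r * x $ i"
  by (subst vector_scaleR_component) (rule scaleR_conv_of_real)

lemma scaleR_nth_nth: "(r *\<^sub>R (A :: complex ^ 'n ^ 'm)) $ i $ j = of_real r * A $ i $ j"
  by (subst vector_scaleR_component) (rule scaleR_nth)

lemma norm_qubit: "(norm (x :: qubit))\<^sup>2 = (cmod (x $ 1))\<^sup>2 + (cmod (x $ 2))\<^sup>2"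
  by (simp add: norm_vec_power2 sum_2)

lemma norm_two_qubit:
  "(norm (\<psi> :: two_qubit))\<^sup>2 = (cmod (\<psi> $ (1,1)))\<^sup>2 + (cmod (\<psi> $ (1,2)))\<^sup>2
     + (cmod (\<psi> $ (2,1)))\<^sup>2 + (cmod (\<psi> $ (2,2)))\<^sup>2"
  by (simp add: norm_vec_power2 sum_UNIV_2x2)

lemma norm_perp [simp]: "norm (perp x) = norm x"
proof -
  have "(norm (perp x))\<^sup>2 = (norm x)\<^sup>2" by (simp add: norm_qubit)
  then show ?thesis by simp
qed

lemma orthonormal_pair_perp: "norm x = 1 \<Longrightarrow> orthonormal_pair x (perp x)"
  by (simp add: orthonormal_pair_def sum_2)

lemma orthonormal_pair_commute: "orthonormal_pair x y \<Longrightarrow> orthonormal_pair y x"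
proof -
  have "(\<Sum>i\<in>UNIV. cnj (y $ i) * x $ i) = cnj (\<Sum>i\<in>UNIV. cnj (x $ i) * y $ i)"
    by (simp add: mult.commute)
  then show "orthonormal_pair x y \<Longrightarrow> orthonormal_pair y x"
    by (simp add: orthonormal_pair_def)
qed

text \<open>Lagrange's identity in two complex dimensions.\<close>

lemma cmod_wedge_power2:
  "(cmod (wedge x y))\<^sup>2 + (cmod (\<Sum>i\<in>UNIV. cnj (x $ i) * y $ i))\<^sup>2 = (norm x)\<^sup>2 * (norm y)\<^sup>2"
proof -
  have "complex_of_real ((cmod (wedge x y))\<^sup>2 + (cmod (\<Sum>i\<in>UNIV. cnj (x $ i) * y $ i))\<^sup>2)
      = of_real ((norm x)\<^sup>2 * (norm y)\<^sup>2)"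
    unfolding norm_qubit wedge_def sum_2 of_real_add of_real_mult complex_norm_square
    by (simp add: algebra_simps)
  then show ?thesis by (simp only: of_real_eq_iff)
qed

lemma cmod_wedge_le: "cmod (wedge x y) \<le> norm x * norm y"
proof (rule power2_le_imp_le)
  show "(cmod (wedge x y))\<^sup>2 \<le> (norm x * norm y)\<^sup>2"
    using cmod_wedge_power2 [of x y] by (simp add: power_mult_distrib) (smt (verit) zero_le_power2)
qed simp

lemma cmod_wedge_orthonormal: "orthonormal_pair x y \<Longrightarrow> cmod (wedge x y) = 1"
  using cmod_wedge_power2 [of x y] by (simp add: orthonormal_pair_def power2_eq_1_iff)
    (smt (verit) norm_ge_zero)

text \<open>Multiplicativity of the determinant: the coefficient matrix is a product of the matrix
  with columns \<open>a1\<close>, \<open>a2\<close>, the diagonal matrix of \<open>s1\<close>,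
  \<open>s2\<close>, and the transposed matrix with columns \<open>b1\<close>,
  \<open>b2\<close>.\<close>

lemma det_vec_sum2:
  "det_vec (s1 *\<^sub>R (a1 \<otimes>\<^sub>v b1) + s2 *\<^sub>R (a2 \<otimes>\<^sub>v b2)) = of_real (s1 * s2) * (wedge a1 a2 * wedge b1 b2)"
  by (simp add: det_vec_def wedge_def scaleR_nth algebra_simps del: vector_scaleR_component)

lemma cmod_det_vec_le: "2 * cmod (det_vec \<psi>) \<le> (norm \<psi>)\<^sup>2"
proof -
  have *: "2 * (x * y) \<le> x\<^sup>2 + y\<^sup>2" for x y :: real
    using sum_squares_bound [of x y] by (simp add: mult.assoc)
  have "2 * cmod (det_vec \<psi>) \<le> 2 * (cmod (\<psi> $ (1,1)) * cmod (\<psi> $ (2,2)))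
      + 2 * (cmod (\<psi> $ (1,2)) * cmod (\<psi> $ (2,1)))"
    unfolding det_vec_def
    by (smt (verit) norm_triangle_ineq4 norm_mult)
  also have "\<dots> \<le> (norm \<psi>)\<^sup>2"
    unfolding norm_two_qubit
    using *[of "cmod (\<psi> $ (1,1))" "cmod (\<psi> $ (2,2))"] *[of "cmod (\<psi> $ (1,2))" "cmod (\<psi> $ (2,1))"]
    by linarith
  finally show ?thesis .
qed

text \<open>A zero vector has no direction of its own; \<open>perp\<close> of the other vector
  supplies one, and if both vanish any orthonormal pair will do.\<close>

lemma orthonormal_pair_polar:
  fixes x y :: qubit
  assumes "(\<Sum>i\<in>UNIV. cnj (x $ i) * y $ i) = 0"
  obtains a b where "orthonormal_pair a b" "x = norm x *\<^sub>R a" "y = norm y *\<^sub>R b"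
proof -
  consider "x \<noteq> 0" "y \<noteq> 0" | "x \<noteq> 0" "y = 0" | "x = 0" "y \<noteq> 0" | "x = 0" "y = 0" by blast
  then show ?thesis
  proof cases
    case 1
    have "(\<Sum>i\<in>UNIV. cnj ((x /\<^sub>R norm x) $ i) * (y /\<^sub>R norm y) $ i)
        = of_real (inverse (norm x) * inverse (norm y)) * (\<Sum>i\<in>UNIV. cnj (x $ i) * y $ i)"
      by (simp add: sum_2 scaleR_nth algebra_simps del: vector_scaleR_component)
    with 1 assms show ?thesis
      by (intro that[of "x /\<^sub>R norm x" "y /\<^sub>R norm y"]) (simp_all add: orthonormal_pair_def)
  next
    case 2
    then show ?thesis
      by (intro that[of "x /\<^sub>R norm x" "perp (x /\<^sub>R norm x)"] orthonormal_pair_perp) simp_all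
  next
    case 3
    then show ?thesis
      by (intro that[of "perp (y /\<^sub>R norm y)" "y /\<^sub>R norm y"]
          orthonormal_pair_commute [OF orthonormal_pair_perp]) simp_all
  next
    case 4
    then show ?thesis
      by (intro that[of "axis 1 1" "perp (axis 1 1)"] orthonormal_pair_perp) (simp_all add: norm_axis_1)
  qed
qed

text \<open>Diagonalising the Gram matrix of \<open>x\<close> and \<open>y\<close>: for \<open>\<langle>x, y\<rangle> = q \<noteq> 0\<close> an eigenvector is
  \<open>(q, t)\<close> with \<open>t\<close> a root of \<open>t\<^sup>2 - (\<parallel>y\<parallel>\<^sup>2 - \<parallel>x\<parallel>\<^sup>2) t - \<bar>q\<bar>\<^sup>2\<close>.\<close>

lemma exists_orthogonal_combination:
  fixes x y :: qubit
  obtains c :: qubit where "norm c = 1"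
    "(\<Sum>i\<in>UNIV. cnj (c $ 1 * x $ i + c $ 2 * y $ i)
        * (perp c $ 1 * x $ i + perp c $ 2 * y $ i)) = 0"
proof -
  define q where "q = (\<Sum>i\<in>UNIV. cnj (x $ i) * y $ i)"
  define p where "p = (norm x)\<^sup>2"
  define r where "r = (norm y)\<^sup>2"
  have qc: "(\<Sum>i\<in>UNIV. cnj (y $ i) * x $ i) = cnj q"
    by (simp add: q_def mult.commute)
  have eq: "(\<Sum>i\<in>UNIV. cnj (c $ 1 * x $ i + c $ 2 * y $ i)
        * (perp c $ 1 * x $ i + perp c $ 2 * y $ i))
      = (cnj (c $ 1))\<^sup>2 * q - (cnj (c $ 2))\<^sup>2 * cnj q
        + cnj (c $ 1) * cnj (c $ 2) * (of_real r - of_real p)" for c :: qubit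
    unfolding p_def r_def norm_vec_power2' qc [symmetric] unfolding q_def sum_2 perp_nth
    by (simp add: power2_eq_square algebra_simps)
  show ?thesis
  \<comment> \<open>For \<open>q = 0\<close> the candidate \<open>(q, t)\<close> may be the zero
    vector, but then \<open>x\<close> and \<open>y\<close> are already orthogonal and the first unit
    vector works.\<close>
  proof (cases "q = 0")
    case True
    show ?thesis
      by (rule that[of "axis 1 1"]) (simp add: norm_axis_1, simp only: eq True, simp add: axis_def)
  next
    case False
    define s where "s = sqrt ((r - p)\<^sup>2 + 4 * (cmod q)\<^sup>2)"
    define t where "t = ((r - p) + s) / 2"
    have "2 * t - (r - p) = s" by (simp add: t_def field_simps)
    then have "(2 * t - (r - p))\<^sup>2 = (r - p)\<^sup>2 + 4 * (cmod q)\<^sup>2"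
      by (simp add: s_def)
    then have "(cmod q)\<^sup>2 - t\<^sup>2 + t * (r - p) = 0"
      by (simp add: power2_eq_square algebra_simps)
    then have "complex_of_real ((cmod q)\<^sup>2 - t\<^sup>2 + t * (r - p)) = 0"
      by (simp only: of_real_0)
    then have t: "q * cnj q - (of_real t)\<^sup>2 + of_real t * (of_real r - of_real p) = 0"
      by (simp add: complex_norm_square flip: of_real_power)
    define c0 :: qubit where "c0 = vector [q, of_real t]"
    have c0: "c0 $ 1 = q" "c0 $ 2 = of_real t" by (simp_all add: c0_def)
    have "c0 \<noteq> 0" using c0 False by (metis zero_index)
    define c where "c = c0 /\<^sub>R norm c0"
    have "norm c = 1" using \<open>c0 \<noteq> 0\<close> by (simp add: c_def)
    moreover have "(cnj (c $ 1))\<^sup>2 * q - (cnj (c $ 2))\<^sup>2 * cnj q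
        + cnj (c $ 1) * cnj (c $ 2) * (of_real r - of_real p)
      = (of_real (inverse (norm c0)))\<^sup>2 * cnj q
        * (q * cnj q - (of_real t)\<^sup>2 + of_real t * (of_real r - of_real p))"
      by (simp add: c_def c0 scaleR_nth power2_eq_square algebra_simps del: vector_scaleR_component)
    ultimately show ?thesis
      by (intro that[of c]) (simp_all only: eq t mult_zero_right)
  qed
qed

text \<open>Singular value decomposition of the 2 by 2 coefficient matrix. The unitary with columns
  \<open>c\<close> and \<open>perp c\<close> combines its columns into orthogonal vectors
  \<open>x\<close> and \<open>y\<close>, whose norms are the Schmidt coefficients and whose
  directions are \<open>a1\<close> and \<open>a2\<close>; undoing that unitary makes the conjugates
  of \<open>c\<close> and \<open>perp c\<close> the second factors.\<close>

lemma schmidt_decomposition: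
  assumes "norm \<psi> = 1"
  obtains s1 s2 a1 a2 b1 b2 where "orthonormal_pair a1 a2" "orthonormal_pair b1 b2"
    "0 \<le> s1" "0 \<le> s2" "s1\<^sup>2 + s2\<^sup>2 = 1" "\<psi> = s1 *\<^sub>R (a1 \<otimes>\<^sub>v b1) + s2 *\<^sub>R (a2 \<otimes>\<^sub>v b2)"
proof -
  obtain c where c: "norm c = 1"
    and orth: "(\<Sum>i\<in>UNIV. cnj (c $ 1 * (\<chi> i. \<psi> $ (i,1)) $ i + c $ 2 * (\<chi> i. \<psi> $ (i,2)) $ i)
        * (perp c $ 1 * (\<chi> i. \<psi> $ (i,1)) $ i + perp c $ 2 * (\<chi> i. \<psi> $ (i,2)) $ i)) = 0"
    by (rule exists_orthogonal_combination)
  define x :: qubit where "x = (\<chi> i. c $ 1 * \<psi> $ (i,1) + c $ 2 * \<psi> $ (i,2))"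
  define y :: qubit where "y = (\<chi> i. perp c $ 1 * \<psi> $ (i,1) + perp c $ 2 * \<psi> $ (i,2))"
  have "(\<Sum>i\<in>UNIV. cnj (x $ i) * y $ i) = 0"
    using orth by (simp add: x_def y_def)
  then obtain a1 a2 where a: "orthonormal_pair a1 a2" "x = norm x *\<^sub>R a1" "y = norm y *\<^sub>R a2"
    by (rule orthonormal_pair_polar)
  define b1 :: qubit where "b1 = (\<chi> i. cnj (c $ i))"
  define b2 :: qubit where "b2 = (\<chi> i. cnj (perp c $ i))"
  have "norm b1 = norm c" "norm b2 = norm (perp c)"
    by (simp_all add: b1_def b2_def norm_vec_def)
  then have b: "orthonormal_pair b1 b2"
    using c by (simp add: orthonormal_pair_def) (simp add: b1_def b2_def sum_2 mult.commute)
  have "complex_of_real ((norm c)\<^sup>2) = 1" using c by simp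
  then have cc: "c $ 1 * cnj (c $ 1) + c $ 2 * cnj (c $ 2) = 1"
    unfolding norm_vec_power2' sum_2 by (simp add: mult.commute)
  have "\<psi> $ (i,j) = x $ i * b1 $ j + y $ i * b2 $ j" for i j
  proof -
    have "x $ i * b1 $ 1 + y $ i * b2 $ 1 = (c $ 1 * cnj (c $ 1) + c $ 2 * cnj (c $ 2)) * \<psi> $ (i,1)"
      "x $ i * b1 $ 2 + y $ i * b2 $ 2 = (c $ 1 * cnj (c $ 1) + c $ 2 * cnj (c $ 2)) * \<psi> $ (i,2)"
      by (simp_all add: x_def y_def b1_def b2_def algebra_simps)
    then have "\<forall>j. \<psi> $ (i,j) = x $ i * b1 $ j + y $ i * b2 $ j"
      unfolding forall_2 cc by simp
    then show ?thesis by blast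
  qed
  then have "\<psi> = x \<otimes>\<^sub>v b1 + y \<otimes>\<^sub>v b2"
    by (simp add: vec_eq_iff)
  also have "\<dots> = norm x *\<^sub>R (a1 \<otimes>\<^sub>v b1) + norm y *\<^sub>R (a2 \<otimes>\<^sub>v b2)"
    by (subst (1) a(2), subst (1) a(3)) (simp add: vec_eq_iff)
  finally have \<psi>: "\<psi> = norm x *\<^sub>R (a1 \<otimes>\<^sub>v b1) + norm y *\<^sub>R (a2 \<otimes>\<^sub>v b2)" .
  have "complex_of_real ((norm x)\<^sup>2 + (norm y)\<^sup>2)
      = (c $ 1 * cnj (c $ 1) + c $ 2 * cnj (c $ 2)) * of_real ((norm \<psi>)\<^sup>2)"
    unfolding norm_vec_power2' of_real_add sum_2 sum_UNIV_2x2
    by (simp add: x_def y_def algebra_simps)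
  then have "complex_of_real ((norm x)\<^sup>2 + (norm y)\<^sup>2) = of_real 1"
    unfolding cc assms by simp
  then have "(norm x)\<^sup>2 + (norm y)\<^sup>2 = 1" by (simp only: of_real_eq_iff)
  with a(1) b \<psi> show ?thesis by (intro that) simp_all
qed

text \<open>Wedges of orthonormal pairs have modulus 1, so every Schmidt decomposition yields the
  same product \<open>s1 * s2\<close>; this is what makes the description in
  \<open>concurrence\<close> unique.\<close>

lemma concurrence_eq:
  assumes "norm \<psi> = 1"
  shows "concurrence \<psi> = 2 * cmod (det_vec \<psi>)"
proof -
  have *: "2 * s1 * s2 = 2 * cmod (det_vec \<psi>)"
    if "orthonormal_pair a1 a2" "orthonormal_pair b1 b2" "0 \<le> s1" "0 \<le> s2"
      "\<psi> = s1 *\<^sub>R (a1 \<otimes>\<^sub>v b1) + s2 *\<^sub>R (a2 \<otimes>\<^sub>v b2)" for s1 s2 a1 a2 b1 b2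
    using that(1-4) unfolding that(5) det_vec_sum2
    by (simp add: norm_mult cmod_wedge_orthonormal)
  obtain s1 s2 a1 a2 b1 b2 where sd: "orthonormal_pair a1 a2" "orthonormal_pair b1 b2"
    "0 \<le> s1" "0 \<le> s2" "s1\<^sup>2 + s2\<^sup>2 = 1" "\<psi> = s1 *\<^sub>R (a1 \<otimes>\<^sub>v b1) + s2 *\<^sub>R (a2 \<otimes>\<^sub>v b2)"
    using schmidt_decomposition [OF assms] .
  show ?thesis
    unfolding concurrence_def
  proof (rule the_equality)
    show "\<exists>s1 s2 a1 a2 b1 b2. orthonormal_pair a1 a2 \<and> orthonormal_pair b1 b2 \<and>
       0 \<le> s1 \<and> 0 \<le> s2 \<and> s1\<^sup>2 + s2\<^sup>2 = 1 \<and>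
       \<psi> = s1 *\<^sub>R (a1 \<otimes>\<^sub>v b1) + s2 *\<^sub>R (a2 \<otimes>\<^sub>v b2) \<and> 2 * cmod (det_vec \<psi>) = 2 * s1 * s2"
      using sd *[OF sd(1-4,6)] by metis
  qed (use * in blast)
qed

lemma norm_kron_vec: "norm (a \<otimes>\<^sub>v b) = norm a * norm b"
proof -
  have "(norm (a \<otimes>\<^sub>v b))\<^sup>2 = (norm a * norm b)\<^sup>2"
    by (simp add: norm_two_qubit norm_qubit norm_mult power_mult_distrib algebra_simps)
  then show ?thesis by (simp add: power2_eq_iff_nonneg)
qed

lemma concurrence_product_input:
  assumes "unitary_mat U" "norm a = 1" "norm b = 1"
  shows "concurrence (U *v (a \<otimes>\<^sub>v b)) = 2 * cmod (det_vec (U *v (a \<otimes>\<^sub>v b)))"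
  by (rule concurrence_eq) (simp add: unitary_mat_norm norm_kron_vec assms)

lemma C_max_attained:
  assumes U: "unitary_mat U"
  shows "\<exists>a b. norm a = 1 \<and> norm b = 1 \<and> C_max U = 2 * cmod (det_vec (U *v (a \<otimes>\<^sub>v b)))" (is ?P)
    and "\<And>a b. norm a = 1 \<Longrightarrow> norm b = 1 \<Longrightarrow> 2 * cmod (det_vec (U *v (a \<otimes>\<^sub>v b))) \<le> C_max U"
proof -
  let ?S = "sphere 0 1 \<times> sphere 0 1 :: (qubit \<times> qubit) set"
  let ?h = "\<lambda>(a, b). 2 * cmod (det_vec (U *v (a \<otimes>\<^sub>v b)))"
  have "compact ?S" by (intro compact_Times compact_sphere)
  moreover have "(axis 1 1, axis 1 1) \<in> ?S" by (simp add: norm_axis_1)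
  moreover have "continuous_on ?S ?h"
    unfolding det_vec_def matrix_vector_mult_def kron_vec_def split_def
    by (simp add: sum_UNIV_2x2) (intro continuous_intros)
  ultimately obtain a b where ab: "norm a = 1" "norm b = 1"
    and max: "\<And>x y. norm x = 1 \<Longrightarrow> norm y = 1 \<Longrightarrow> ?h (x, y) \<le> ?h (a, b)"
    using continuous_attains_sup [of ?S ?h] by (auto 0 4)
  have "C_max U = ?h (a, b)"
    unfolding C_max_def
  proof (rule Greatest_equality)
    show "\<exists>a' b'. norm a' = 1 \<and> norm b' = 1 \<and> ?h (a, b) = concurrence (U *v (a' \<otimes>\<^sub>v b'))"
      using ab by (intro exI[of _ a] exI[of _ b]) (simp add: concurrence_product_input U)
  next
    fix c assume "\<exists>a b. norm a = 1 \<and> norm b = 1 \<and> c = concurrence (U *v (a \<otimes>\<^sub>v b))"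
    then show "c \<le> ?h (a, b)" using max by (auto simp: concurrence_product_input U)
  qed
  then show ?P "\<And>a b. norm a = 1 \<Longrightarrow> norm b = 1 \<Longrightarrow> 2 * cmod (det_vec (U *v (a \<otimes>\<^sub>v b))) \<le> C_max U"
    using ab max by auto
qed

lemma C_max_eqI:
  assumes "unitary_mat U"
    and "\<And>a b. norm a = 1 \<Longrightarrow> norm b = 1 \<Longrightarrow> 2 * cmod (det_vec (U *v (a \<otimes>\<^sub>v b))) \<le> c"
    and "norm a = 1" "norm b = 1" "2 * cmod (det_vec (U *v (a \<otimes>\<^sub>v b))) = c"
  shows "C_max U = c"
  using C_max_attained [OF assms(1)] assms(2-) by (metis order_antisym)

lemma C_max_bounds:
  assumes "unitary_mat U"
  shows "0 \<le> C_max U" "C_max U \<le> 1"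
proof -
  obtain a b where ab: "norm a = 1" "norm b = 1" "C_max U = 2 * cmod (det_vec (U *v (a \<otimes>\<^sub>v b)))"
    using C_max_attained(1) [OF assms] by blast
  show "0 \<le> C_max U" by (simp add: ab)
  show "C_max U \<le> 1"
    using cmod_det_vec_le [of "U *v (a \<otimes>\<^sub>v b)"] ab by (simp add: unitary_mat_norm norm_kron_vec assms)
qed

section \<open>The canonical gates in the magic basis\<close>

definition pauli_comb :: "(nat \<Rightarrow> complex) \<Rightarrow> gate2" where
  "pauli_comb u = (\<Sum>j\<le>3. cscale (u j) (pauli j \<otimes>\<^sub>m pauli j))"

text \<open>The product of the commuting factors cos + i sin \<sigma>\<otimes>\<sigma> for the three
  angles, expanded with (X\<otimes>X)(Y\<otimes>Y) = -(Z\<otimes>Z) and its cyclic versions.\<close>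

definition pauli_coeff :: "real \<Rightarrow> real \<Rightarrow> real \<Rightarrow> nat \<Rightarrow> complex" where
  "pauli_coeff x y z j =
    [Complex (cos x * cos y * cos z) (sin x * sin y * sin z),
     Complex (cos x * sin y * sin z) (sin x * cos y * cos z),
     Complex (sin x * cos y * sin z) (cos x * sin y * cos z),
     Complex (sin x * sin y * cos z) (cos x * cos y * sin z)] ! j"

lemma pauli_coeff_simps [simp]:
  "pauli_coeff x y z 0 = Complex (cos x * cos y * cos z) (sin x * sin y * sin z)"
  "pauli_coeff x y z 1 = Complex (cos x * sin y * sin z) (sin x * cos y * cos z)"
  "pauli_coeff x y z (Suc 0) = Complex (cos x * sin y * sin z) (sin x * cos y * cos z)"
  "pauli_coeff x y z 2 = Complex (sin x * cos y * sin z) (cos x * sin y * cos z)"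
  "pauli_coeff x y z 3 = Complex (sin x * sin y * cos z) (cos x * cos y * sin z)"
  by (simp_all add: pauli_coeff_def numeral_eq_Suc)

definition diag_mat :: "('n::finite \<Rightarrow> complex) \<Rightarrow> complex ^ 'n ^ 'n" where
  "diag_mat d = (\<chi> i j. if i = j then d i else 0)"

lemma mult_diag_mat_nth: "(A ** diag_mat d) $ i $ j = A $ i $ j * d j"
  by (simp add: matrix_matrix_mult_def diag_mat_def if_distrib cong: if_cong)

lemma diag_mat_mult: "diag_mat c ** diag_mat d = diag_mat (\<lambda>i. c i * d i)"
  by (simp add: vec_eq_iff mult_diag_mat_nth) (simp add: diag_mat_def)

text \<open>The columns of \<open>magic\<close> are maximally entangled and diagonalise all
  \<open>pauli j \<otimes>\<^sub>m pauli j\<close>; up to the factor \<open>1 / sqrt 2\<close> their coefficient matrices are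
  $\mathbb I, iX, iY, iZ$, so that real vectors correspond to quaternions.\<close>

definition magic :: gate2 where
  "magic = (\<chi> i k. of_real (1 / sqrt 2) *
     (if k = (1,1) then pauli 0 else cscale \<i> (pauli (if k = (1,2) then 1 else if k = (2,1) then 2 else 3)))
       $ fst i $ snd i)"

lemma magic_nth:
  "magic $ i $ (1,1) = of_real (1 / sqrt 2) * pauli 0 $ fst i $ snd i"
  "magic $ i $ (1,2) = of_real (1 / sqrt 2) * (\<i> * pauli 1 $ fst i $ snd i)"
  "magic $ i $ (2,1) = of_real (1 / sqrt 2) * (\<i> * pauli 2 $ fst i $ snd i)"
  "magic $ i $ (2,2) = of_real (1 / sqrt 2) * (\<i> * pauli 3 $ fst i $ snd i)"
  by (simp_all add: magic_def)

lemma half_sqrt_2: "complex_of_real (1 / sqrt 2) * complex_of_real (1 / sqrt 2) = 1 / 2"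
  by (simp flip: of_real_mult)

lemma half_sqrt_2': "complex_of_real (1 / sqrt 2) * (complex_of_real (1 / sqrt 2) * z) = z / 2"
  by (simp only: mult.assoc [symmetric] half_sqrt_2) simp

lemma unitary_magic: "unitary_mat magic"
proof -
  have r: "cnj (of_real (1 / sqrt 2) * x) * (of_real (1 / sqrt 2) * y) = cnj x * y / 2" for x y
    using half_sqrt_2' [of "cnj x * y"] by (simp add: mult_ac del: of_real_divide)
  have "\<forall>i j. (adjoint_mat magic ** magic) $ i $ j = mat 1 $ i $ j"
    by (simp only: forall_2x2 matrix_matrix_mult_def vec_lambda_beta sum_UNIV_2x2 adjoint_mat_nth magic_nth r)
      (simp add: mat_def)
  then have "adjoint_mat magic ** magic = mat 1"
    by (simp add: vec_eq_iff)
  then show ?thesis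
    by (simp add: unitary_mat_def matrix_left_right_inverse)
qed

lemma bounded_linear_cscale: "bounded_linear (\<lambda>c. cscale c A)"
  unfolding linear_conv_bounded_linear [symmetric]
  by (rule linearI) (simp_all add: vec_eq_iff algebra_simps)

text \<open>Expanding over the rank-one spectral projections \<open>P k\<close> turns the matrix
  series into finitely many scalar exponential series.\<close>

lemma mat_exp_diagonalisable:
  fixes B B' :: "complex ^ 'n::finite ^ 'n"
  assumes "B ** B' = mat 1" "B' ** B = mat 1"
  shows "mat_exp (B ** diag_mat d ** B') = B ** diag_mat (\<lambda>k. exp (d k)) ** B'"
proof -
  let ?A = "B ** diag_mat d ** B'"
  define P where "P k = (\<chi> i j. B $ i $ k * B' $ k $ j)" for k
  have P: "B ** diag_mat c ** B' = (\<Sum>k\<in>UNIV. cscale (c k) (P k))" for c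
    by (simp add: vec_eq_iff matrix_matrix_mult_def[of _ B'] mult_diag_mat_nth P_def mult_ac)
  have pow: "((**) ?A ^^ n) (mat 1) = B ** diag_mat (\<lambda>k. d k ^ n) ** B'" for n
  proof (induction n)
    case 0
    have "diag_mat (\<lambda>k::'n. 1) = mat 1" by (simp add: diag_mat_def mat_def)
    then show ?case using assms by simp
  next
    case (Suc n)
    have "((**) ?A ^^ Suc n) (mat 1) = B ** diag_mat d ** (B' ** B) ** diag_mat (\<lambda>k. d k ^ n) ** B'"
      by (simp add: Suc.IH matrix_mul_assoc)
    also have "\<dots> = B ** (diag_mat d ** diag_mat (\<lambda>k. d k ^ n)) ** B'"
      by (simp add: assms matrix_mul_assoc)
    finally show ?case by (simp add: diag_mat_mult)
  qed
  have "(\<lambda>n. (1 / fact n) *\<^sub>R ((**) ?A ^^ n) (mat 1)) = (\<lambda>n. \<Sum>k\<in>UNIV. cscale (d k ^ n /\<^sub>R fact n) (P k))"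
    unfolding pow unfolding P
    by (simp add: vec_eq_iff fun_eq_iff scaleR_sum_right divide_inverse)
  moreover have "(\<lambda>n. \<Sum>k\<in>UNIV. cscale (d k ^ n /\<^sub>R fact n) (P k)) sums (\<Sum>k\<in>UNIV. cscale (exp (d k)) (P k))"
    by (intro sums_sum bounded_linear.sums [OF bounded_linear_cscale] exp_converges)
  ultimately show ?thesis
    by (simp only: mat_exp_def P [of "\<lambda>k. exp (d k)"] sums_iff)
qed

text \<open>The eigenvalues of x X\<otimes>X + y Y\<otimes>Y + z Z\<otimes>Z on the four columns of
  \<open>magic\<close>, which are Bell states up to phases.\<close>

definition magic_phase :: "real \<Rightarrow> real \<Rightarrow> real \<Rightarrow> 2 \<times> 2 \<Rightarrow> real" where
  "magic_phase x y z k =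
    (if k = (1,1) then x - y + z else if k = (1,2) then x + y - z
     else if k = (2,1) then - x - y - z else - x + y + z)"

lemma magic_phase_simps [simp]:
  "magic_phase x y z (1,1) = x - y + z" "magic_phase x y z (1,2) = x + y - z"
  "magic_phase x y z (2,1) = - x - y - z" "magic_phase x y z (2,2) = - x + y + z"
  by (simp_all add: magic_phase_def)

lemma magic_diag_mat_nth:
  "(magic ** diag_mat d ** adjoint_mat magic) $ i $ j =
    (d (1,1) * (pauli 0 $ fst i $ snd i * cnj (pauli 0 $ fst j $ snd j))
   + d (1,2) * (pauli 1 $ fst i $ snd i * cnj (pauli 1 $ fst j $ snd j))
   + d (2,1) * (pauli 2 $ fst i $ snd i * cnj (pauli 2 $ fst j $ snd j))
   + d (2,2) * (pauli 3 $ fst i $ snd i * cnj (pauli 3 $ fst j $ snd j))) / 2"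
proof -
  have r: "(of_real (1 / sqrt 2) * x) * d * cnj (of_real (1 / sqrt 2) * y) = d * (x * cnj y) / 2"
    for x d y :: complex
    using half_sqrt_2' [of "d * (x * cnj y)"] by (simp add: mult_ac del: of_real_divide)
  have i: "\<i> * x * (\<i> * y) = - (x * y)" for x y
    by (simp add: mult.left_commute [of x \<i>] mult.assoc)
  show ?thesis
    by (simp only: matrix_matrix_mult_def[of _ "adjoint_mat _"] vec_lambda_beta mult_diag_mat_nth sum_UNIV_2x2
       adjoint_mat_nth magic_nth r) (simp add: i add_divide_distrib)
qed

lemma U_d_magic: "U_d x y z = magic ** diag_mat (\<lambda>k. exp (\<i> * of_real (magic_phase x y z k))) ** adjoint_mat magic"
proof -
  have "cscale \<i> (x *\<^sub>R (pauli 1 \<otimes>\<^sub>m pauli 1) + y *\<^sub>R (pauli 2 \<otimes>\<^sub>m pauli 2) + z *\<^sub>R (pauli 3 \<otimes>\<^sub>m pauli 3))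
      = magic ** diag_mat (\<lambda>k. \<i> * of_real (magic_phase x y z k)) ** adjoint_mat magic"
    by (simp add: vec22_eq_iff magic_diag_mat_nth complex_eq_iff)
  then show ?thesis
    by (simp add: U_d_def mat_exp_diagonalisable unitary_magic unitary_matD)
qed

lemma pauli_comb_nth: "pauli_comb u $ i $ j =
   u 0 * (pauli 0 $ fst i $ fst j * pauli 0 $ snd i $ snd j)
 + u 1 * (pauli 1 $ fst i $ fst j * pauli 1 $ snd i $ snd j)
 + u 2 * (pauli 2 $ fst i $ fst j * pauli 2 $ snd i $ snd j)
 + u 3 * (pauli 3 $ fst i $ fst j * pauli 3 $ snd i $ snd j)"
  unfolding pauli_comb_def sum_atMost_3 by simp

lemma U_d_pauli_comb: "U_d x y z = pauli_comb (pauli_coeff x y z)"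
proof -
  have e: "exp (\<i> * of_real t) = Complex (cos t) (sin t)" for t
    by (simp add: cis_conv_exp [symmetric] cis.ctr)
  have p: "exp (\<i> * of_real (magic_phase x y z k)) =
     Complex (cos (magic_phase x y z k)) (sin (magic_phase x y z k))" for k
    by (rule e)
  define C where "C k = cos (magic_phase x y z k)" for k
  define S where "S k = sin (magic_phase x y z k)" for k
  let ?u = "pauli_coeff x y z"
  \<comment> \<open>In the computational basis \<open>pauli_comb u\<close> has two 2 by 2 blocks, on
    00, 11 and on 01, 10. Their entries are exactly the sums and differences of \<open>u 0\<close>,
    \<open>u 3\<close> and of \<open>u 1\<close>, \<open>u 2\<close>, so these combinations are what
    has to be compared.\<close>
  have "Re (?u 0) + Re (?u 3) = (C (1,1) + C (2,2)) / 2"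
    "Re (?u 0) - Re (?u 3) = (C (1,2) + C (2,1)) / 2"
    "Re (?u 1) - Re (?u 2) = (C (1,1) - C (2,2)) / 2"
    "Re (?u 1) + Re (?u 2) = (C (1,2) - C (2,1)) / 2"
    "Im (?u 0) + Im (?u 3) = (S (1,1) + S (2,2)) / 2"
    "Im (?u 0) - Im (?u 3) = (S (1,2) + S (2,1)) / 2"
    "Im (?u 1) - Im (?u 2) = (S (1,1) - S (2,2)) / 2"
    "Im (?u 1) + Im (?u 2) = (S (1,2) - S (2,1)) / 2"
    by (simp_all add: C_def S_def cos_add sin_add cos_diff sin_diff) (simp_all add: field_simps)
  then have u: "?u 0 + ?u 3 = (Complex (C (1,1)) (S (1,1)) + Complex (C (2,2)) (S (2,2))) / 2"
    "?u 0 - ?u 3 = (Complex (C (1,2)) (S (1,2)) + Complex (C (2,1)) (S (2,1))) / 2"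
    "?u 1 - ?u 2 = (Complex (C (1,1)) (S (1,1)) - Complex (C (2,2)) (S (2,2))) / 2"
    "?u 1 + ?u 2 = (Complex (C (1,2)) (S (1,2)) - Complex (C (2,1)) (S (2,1))) / 2"
    by (simp_all only: complex_eq_iff plus_complex.sel minus_complex.sel complex.sel Re_divide_numeral Im_divide_numeral)
  show ?thesis
    unfolding U_d_magic p C_def [symmetric] S_def [symmetric]
    using u by (simp add: vec22_eq_iff magic_diag_mat_nth pauli_comb_nth
       del: One_nat_def pauli_coeff_simps Complex_eq)
qed

section \<open>Local equivalence and the extent\<close>

text \<open>\<open>cartan_form\<close> without its inequalities, so that angles can be changed along
  a chain of equivalences and the region enforced only at the end.\<close>

definition locally_equiv :: "gate2 \<Rightarrow> gate2 \<Rightarrow> bool" where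
  "locally_equiv U V \<longleftrightarrow>
     (\<exists>V1 V2 V3 V4. unitary_mat V1 \<and> unitary_mat V2 \<and> unitary_mat V3 \<and> unitary_mat V4 \<and>
        U = (V1 \<otimes>\<^sub>m V2) ** V ** (V3 \<otimes>\<^sub>m V4))"

lemma locally_equivI:
  assumes "unitary_mat V1" "unitary_mat V2" "unitary_mat V3" "unitary_mat V4"
    "U = (V1 \<otimes>\<^sub>m V2) ** V ** (V3 \<otimes>\<^sub>m V4)"
  shows "locally_equiv U V"
  using assms unfolding locally_equiv_def by blast

lemma cartan_form_iff:
  "cartan_form U x y z \<longleftrightarrow> \<bar>z\<bar> \<le> y \<and> y \<le> x \<and> x \<le> pi / 4 \<and> locally_equiv U (U_d x y z)"
  by (simp add: cartan_form_def locally_equiv_def)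

lemma locally_equiv_refl: "locally_equiv U U"
  by (rule locally_equivI [of "mat 1" "mat 1" "mat 1" "mat 1"])
    (simp_all add: unitary_mat_mat_1 kron_mat_1)

lemma locally_equiv_sym:
  assumes "locally_equiv U V"
  shows "locally_equiv V U"
proof -
  obtain V1 V2 V3 V4 where V: "unitary_mat V1" "unitary_mat V2" "unitary_mat V3" "unitary_mat V4"
    "U = (V1 \<otimes>\<^sub>m V2) ** V ** (V3 \<otimes>\<^sub>m V4)"
    using assms by (auto simp: locally_equiv_def)
  have "(adjoint_mat V1 \<otimes>\<^sub>m adjoint_mat V2) ** U ** (adjoint_mat V3 \<otimes>\<^sub>m adjoint_mat V4)
      = ((adjoint_mat V1 \<otimes>\<^sub>m adjoint_mat V2) ** (V1 \<otimes>\<^sub>m V2)) ** V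
        ** ((V3 \<otimes>\<^sub>m V4) ** (adjoint_mat V3 \<otimes>\<^sub>m adjoint_mat V4))"
    by (simp only: V(5) matrix_mul_assoc)
  also have "\<dots> = V"
    using V by (simp add: kron_mult unitary_matD kron_mat_1)
  finally show ?thesis
    using V by (intro locally_equivI [of "adjoint_mat V1" "adjoint_mat V2" "adjoint_mat V3" "adjoint_mat V4"])
      (simp_all add: unitary_mat_adjoint)
qed

lemma locally_equiv_trans:
  assumes "locally_equiv U V" "locally_equiv V W"
  shows "locally_equiv U W"
proof -
  obtain V1 V2 V3 V4 where V: "unitary_mat V1" "unitary_mat V2" "unitary_mat V3" "unitary_mat V4"
    "U = (V1 \<otimes>\<^sub>m V2) ** V ** (V3 \<otimes>\<^sub>m V4)"
    using assms(1) by (auto simp: locally_equiv_def)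
  obtain W1 W2 W3 W4 where W: "unitary_mat W1" "unitary_mat W2" "unitary_mat W3" "unitary_mat W4"
    "V = (W1 \<otimes>\<^sub>m W2) ** W ** (W3 \<otimes>\<^sub>m W4)"
    using assms(2) by (auto simp: locally_equiv_def)
  have "U = ((V1 \<otimes>\<^sub>m V2) ** (W1 \<otimes>\<^sub>m W2)) ** W ** ((W3 \<otimes>\<^sub>m W4) ** (V3 \<otimes>\<^sub>m V4))"
    by (simp only: V(5) W(5) matrix_mul_assoc)
  then show ?thesis
    using V W by (intro locally_equivI [of "V1 ** W1" "V2 ** W2" "W3 ** V3" "W4 ** V4"])
      (simp_all add: unitary_mat_mult kron_mult)
qed

section \<open>Invariance of the Pauli coefficient sum under local unitaries\<close>

lemma matrix_mult_add_rdistrib: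
  fixes A B :: "'a::semiring_1 ^ 'n::finite ^ 'm"
  shows "(A + B) ** C = A ** C + B ** C"
  by (simp add: vec_eq_iff matrix_matrix_mult_def distrib_right sum.distrib)

lemma local_mult_pauli_comb:
  "(A \<otimes>\<^sub>m B) ** pauli_comb u ** (C \<otimes>\<^sub>m D)
    = (\<Sum>j\<le>3. cscale (u j) ((A ** pauli j ** C) \<otimes>\<^sub>m (B ** pauli j ** D)))"
  unfolding pauli_comb_def sum_atMost_3
  by (simp only: matrix_add_ldistrib matrix_mult_add_rdistrib cscale_mult_left cscale_mult_right kron_mult)

text \<open>Half the trace of \<open>pauli j ** W\<close>, hence the coefficient of \<open>W\<close>
  at \<open>pauli j\<close> in the Pauli basis.\<close>

definition pauli_proj :: "nat \<Rightarrow> gate1 \<Rightarrow> complex" where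
  "pauli_proj j W = (\<Sum>a\<in>UNIV. \<Sum>b\<in>UNIV. pauli j $ a $ b * W $ b $ a) / 2"

lemma parseval_pauli_proj:
  assumes "unitary_mat W"
  shows "(\<Sum>j\<le>3. (cmod (pauli_proj j W))\<^sup>2) = 1"
proof -
  have "(cmod (W $ 1 $ i))\<^sup>2 + (cmod (W $ 2 $ i))\<^sup>2 = 1" for i
  proof -
    have "(adjoint_mat W ** W) $ i $ i = 1"
      using assms by (simp add: unitary_matD mat_def)
    then have "complex_of_real ((cmod (W $ 1 $ i))\<^sup>2 + (cmod (W $ 2 $ i))\<^sup>2) = of_real 1"
      unfolding of_real_add complex_norm_square
      by (simp add: matrix_matrix_mult_def sum_2 mult.commute)
    then show ?thesis by (simp only: of_real_eq_iff)
  qed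
  note col = this[of 1] this[of 2]
  have "(\<Sum>j\<le>3. (cmod (pauli_proj j W))\<^sup>2)
      = ((cmod (W $ 1 $ 1))\<^sup>2 + (cmod (W $ 2 $ 1))\<^sup>2 + ((cmod (W $ 1 $ 2))\<^sup>2 + (cmod (W $ 2 $ 2))\<^sup>2)) / 2"
    unfolding sum_atMost_3 cmod_power2 pauli_proj_def sum_2
    by (simp add: power2_eq_square field_simps)
  then show ?thesis by (simp only: col) simp
qed

lemma pauli_comb_eq_coeff:
  fixes A B :: "nat \<Rightarrow> gate1"
  assumes "pauli_comb v = (\<Sum>k\<le>3. cscale (u k) (A k \<otimes>\<^sub>m B k))" and "j \<le> 3"
  shows "v j = (\<Sum>k\<le>3. u k * (pauli_proj j (A k) * pauli_proj j (B k)))"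
proof -
  \<comment> \<open>A quarter of the trace against \<open>pauli j \<otimes>\<^sub>m pauli j\<close>:
    this functional extracts \<open>v j\<close> on one side and factorises on each tensor product on
    the other.\<close>
  define F where "F M = (\<Sum>a\<in>UNIV. \<Sum>b\<in>UNIV. \<Sum>c\<in>UNIV. \<Sum>d\<in>UNIV.
      pauli j $ a $ b * pauli j $ c $ d * M $ (b,d) $ (a,c)) / 4" for M :: gate2
  have "j = 0 \<or> j = 1 \<or> j = 2 \<or> j = 3" using assms(2) by linarith
  then have "F (pauli_comb v) = v j"
    by (elim disjE) (simp_all add: F_def sum_2 pauli_comb_nth)
  moreover have "F (cscale c (A \<otimes>\<^sub>m B)) = c * (pauli_proj j A * pauli_proj j B)" for c A B
    by (simp add: F_def pauli_proj_def sum_2 algebra_simps)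
  moreover have "F (M + M') = F M + F M'" for M M'
    by (simp add: F_def sum.distrib distrib_left add_divide_distrib)
  ultimately show ?thesis
    using assms(1) by (simp add: sum_atMost_3)
qed

text \<open>\<open>\<Sum>j\<le>3. cmod (v j)\<close> is half the nuclear norm of the realigned matrix of \<open>pauli_comb v\<close>,
  whence its invariance under local unitaries.\<close>

lemma sum_cmod_pauli_comb_le:
  fixes A B :: "nat \<Rightarrow> gate1"
  assumes "pauli_comb v = (\<Sum>k\<le>3. cscale (u k) (A k \<otimes>\<^sub>m B k))"
    and unitary: "\<And>k. k \<le> 3 \<Longrightarrow> unitary_mat (A k)" "\<And>k. k \<le> 3 \<Longrightarrow> unitary_mat (B k)"
  shows "(\<Sum>j\<le>3. cmod (v j)) \<le> (\<Sum>k\<le>3. cmod (u k))"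
proof -
  let ?a = "\<lambda>j k. cmod (pauli_proj j (A k))" and ?b = "\<lambda>j k. cmod (pauli_proj j (B k))"
  have "(\<Sum>j\<le>3. cmod (v j)) \<le> (\<Sum>j\<le>3. \<Sum>k\<le>3. cmod (u k) * (?a j k * ?b j k))"
    by (intro sum_mono) (simp add: pauli_comb_eq_coeff [OF assms(1)] sum_norm_le norm_mult)
  also have "\<dots> = (\<Sum>k\<le>3. cmod (u k) * (\<Sum>j\<le>3. ?a j k * ?b j k))"
    by (subst sum.swap) (simp add: sum_distrib_left)
  also have "\<dots> \<le> (\<Sum>k\<le>3. cmod (u k) * 1)"
  proof (intro sum_mono mult_left_mono)
    fix k :: nat assume "k \<in> {..3}"
    \<comment> \<open>The arithmetic-geometric mean inequality reduces the mixed sum to the two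
      Parseval sums, each equal to 1.\<close>
    have "(\<Sum>j\<le>3. ?a j k * ?b j k) \<le> (\<Sum>j\<le>3. ((?a j k)\<^sup>2 + (?b j k)\<^sup>2) / 2)"
    proof (rule sum_mono)
      fix j
      show "?a j k * ?b j k \<le> ((?a j k)\<^sup>2 + (?b j k)\<^sup>2) / 2"
        using sum_squares_bound [of "?a j k" "?b j k"] by simp
    qed
    also have "\<dots> = 1"
      using unitary \<open>k \<in> {..3}\<close>
      by (simp add: sum.distrib parseval_pauli_proj flip: sum_divide_distrib)
    finally show "(\<Sum>j\<le>3. ?a j k * ?b j k) \<le> 1" .
  qed simp
  finally show ?thesis by simp
qed

lemma locally_equiv_sum_cmod:
  assumes "locally_equiv (pauli_comb v) (pauli_comb u)"
  shows "(\<Sum>j\<le>3. cmod (v j)) = (\<Sum>j\<le>3. cmod (u j))"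
proof -
  have le: "(\<Sum>j\<le>3. cmod (v j)) \<le> (\<Sum>k\<le>3. cmod (u k))"
    if equiv: "locally_equiv (pauli_comb v) (pauli_comb u)" for u v
  proof -
    obtain V1 V2 V3 V4 where V: "unitary_mat V1" "unitary_mat V2" "unitary_mat V3" "unitary_mat V4"
      "pauli_comb v = (V1 \<otimes>\<^sub>m V2) ** pauli_comb u ** (V3 \<otimes>\<^sub>m V4)"
      using equiv unfolding locally_equiv_def by blast
    show ?thesis
      by (rule sum_cmod_pauli_comb_le [OF V(5) [unfolded local_mult_pauli_comb]])
        (simp_all add: V unitary_mat_mult unitary_mat_pauli)
  qed
  show ?thesis
    using le[OF assms] le[OF locally_equiv_sym[OF assms]] by simp
qed

text \<open>Any two Cartan forms of \<open>U\<close> give locally equivalent Pauli combinations, so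
  their coefficient sums agree and the description in \<open>extent\<close> has a unique
  value.\<close>

lemma extent_eq:
  assumes "cartan_form U x y z"
  shows "\<gamma> U = 2 * (\<Sum>j\<le>3. cmod (pauli_coeff x y z j))\<^sup>2 - 1"
  unfolding extent_def
proof (rule the_equality)
  show "\<exists>\<theta>1 \<theta>2 \<theta>3 u p. cartan_form U \<theta>1 \<theta>2 \<theta>3 \<and>
     U_d \<theta>1 \<theta>2 \<theta>3 = (\<Sum>j\<le>3. cscale (u j) (pauli j \<otimes>\<^sub>m pauli j)) \<and>
     (\<forall>j::nat. p j = (cmod (u j))\<^sup>2) \<and>
     2 * (\<Sum>j\<le>3. cmod (pauli_coeff x y z j))\<^sup>2 - 1 = 2 * (\<Sum>j\<le>3. sqrt (p j))\<^sup>2 - 1"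
    using assms
    by (intro exI[of _ x] exI[of _ y] exI[of _ z] exI[of _ "pauli_coeff x y z"]
        exI[of _ "\<lambda>j. (cmod (pauli_coeff x y z j))\<^sup>2"])
      (simp add: U_d_pauli_comb pauli_comb_def)
next
  fix g
  assume "\<exists>\<theta>1 \<theta>2 \<theta>3 u p. cartan_form U \<theta>1 \<theta>2 \<theta>3 \<and>
     U_d \<theta>1 \<theta>2 \<theta>3 = (\<Sum>j\<le>3. cscale (u j) (pauli j \<otimes>\<^sub>m pauli j)) \<and>
     (\<forall>j::nat. p j = (cmod (u j))\<^sup>2) \<and> g = 2 * (\<Sum>j\<le>3. sqrt (p j))\<^sup>2 - 1"
  then obtain x' y' z' u p where *: "cartan_form U x' y' z'" "U_d x' y' z' = pauli_comb u"
    "\<forall>j::nat. p j = (cmod (u j))\<^sup>2" "g = 2 * (\<Sum>j\<le>3. sqrt (p j))\<^sup>2 - 1"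
    unfolding pauli_comb_def by blast
  have "locally_equiv (pauli_comb u) (pauli_comb (pauli_coeff x y z))"
    using *(1) assms unfolding cartan_form_iff *(2) U_d_pauli_comb [of x y z]
    by (blast intro: locally_equiv_trans locally_equiv_sym)
  from locally_equiv_sum_cmod [OF this] *(3,4)
  show "g = 2 * (\<Sum>j\<le>3. cmod (pauli_coeff x y z j))\<^sup>2 - 1" by simp
qed

lemma sum_cmod_pauli_coeff_power2: "(\<Sum>j\<le>3. (cmod (pauli_coeff x y z j))\<^sup>2) = 1"
proof -
  have "(\<Sum>j\<le>3. (cmod (pauli_coeff x y z j))\<^sup>2)
    = ((cos x)\<^sup>2 + (sin x)\<^sup>2) * ((cos y)\<^sup>2 + (sin y)\<^sup>2) * ((cos z)\<^sup>2 + (sin z)\<^sup>2)"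
    unfolding sum_atMost_3 pauli_coeff_simps cmod_power2 complex.sel by algebra
  then show ?thesis by simp
qed

section \<open>The two inequalities\<close>

lemma extent_le_7:
  assumes "cartan_form U x y z"
  shows "\<gamma> U \<le> 7"
proof -
  have "(\<Sum>j\<le>3. cmod (pauli_coeff x y z j) * 1)\<^sup>2
      \<le> (\<Sum>j\<le>3. (cmod (pauli_coeff x y z j))\<^sup>2) * (\<Sum>j\<le>3::nat. 1\<^sup>2)"
    by (rule Cauchy_Schwarz_ineq_sum)
  then show ?thesis
    by (simp add: extent_eq [OF assms] sum_cmod_pauli_coeff_power2)
qed

text \<open>By Cauchy--Binet \<open>det_vec\<close> has no diagonal terms \<open>u j * u j\<close>.\<close>

lemma cmod_det_vec_comb_le:
  fixes x y :: "nat \<Rightarrow> qubit"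
  assumes "\<And>j. j \<le> 3 \<Longrightarrow> norm (x j) = 1" "\<And>j. j \<le> 3 \<Longrightarrow> norm (y j) = 1"
  shows "2 * cmod (det_vec (\<Sum>j\<le>3. u j *s (x j \<otimes>\<^sub>v y j)))
    \<le> (\<Sum>j\<le>3. cmod (u j))\<^sup>2 - (\<Sum>j\<le>3. (cmod (u j))\<^sup>2)"
proof -
  let ?t = "\<lambda>j k. u j * u k * (wedge (x j) (x k) * wedge (y j) (y k))"
  have t: "cmod (?t j k) \<le> cmod (u j) * cmod (u k)" if "j \<le> 3" "k \<le> 3" for j k
  proof -
    have "cmod (wedge (x j) (x k)) * cmod (wedge (y j) (y k)) \<le> 1 * 1"
      using cmod_wedge_le [of "x j" "x k"] cmod_wedge_le [of "y j" "y k"] assms that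
      by (intro mult_mono) auto
    then show ?thesis
      by (simp add: norm_mult mult_left_le)
  qed
  have "det_vec (\<Sum>j\<le>3. u j *s (x j \<otimes>\<^sub>v y j))
      = ?t 0 1 + ?t 0 2 + ?t 0 3 + ?t 1 2 + ?t 1 3 + ?t 2 3"
    unfolding sum_atMost_3 by (simp add: det_vec_def wedge_def) (simp add: algebra_simps)
  then have "cmod (det_vec (\<Sum>j\<le>3. u j *s (x j \<otimes>\<^sub>v y j)))
      \<le> cmod (?t 0 1) + cmod (?t 0 2) + cmod (?t 0 3) + cmod (?t 1 2) + cmod (?t 1 3) + cmod (?t 2 3)"
    by (simp only:) (intro norm_triangle_mono order_refl)
  also have "\<dots> \<le> cmod (u 0) * cmod (u 1) + cmod (u 0) * cmod (u 2) + cmod (u 0) * cmod (u 3)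
      + cmod (u 1) * cmod (u 2) + cmod (u 1) * cmod (u 3) + cmod (u 2) * cmod (u 3)"
    by (intro add_mono t) simp_all
  finally show ?thesis
    by (simp add: sum_atMost_3 power2_eq_square algebra_simps)
qed

lemma C_max_le_extent:
  assumes U: "unitary_mat U" and c: "cartan_form U x y z"
  shows "1 + 2 * C_max U \<le> \<gamma> U"
proof -
  let ?u = "pauli_coeff x y z"
  obtain a b where ab: "norm a = 1" "norm b = 1" "C_max U = 2 * cmod (det_vec (U *v (a \<otimes>\<^sub>v b)))"
    using C_max_attained(1) [OF U] by blast
  obtain V1 V2 V3 V4 where V: "unitary_mat V1" "unitary_mat V2" "unitary_mat V3" "unitary_mat V4"
    "U = (V1 \<otimes>\<^sub>m V2) ** pauli_comb ?u ** (V3 \<otimes>\<^sub>m V4)"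
    using c unfolding cartan_form_def U_d_pauli_comb by blast
  define f where "f j = (V1 ** pauli j ** V3) *v a" for j
  define g where "g j = (V2 ** pauli j ** V4) *v b" for j
  have "cscale w M *v v = w *s (M *v v)" for w and M :: gate2 and v
    by (simp add: vec_eq_iff matrix_vector_mult_def sum_distrib_left mult.assoc)
  then have "U *v (a \<otimes>\<^sub>v b) = (\<Sum>j\<le>3. ?u j *s (f j \<otimes>\<^sub>v g j))"
    unfolding V(5) local_mult_pauli_comb sum_atMost_3
    by (simp only: matrix_vector_mult_add_rdistrib kron_mult_vec f_def g_def)
  moreover have "norm (f j) = 1" "norm (g j) = 1" if "j \<le> 3" for j
    using that V ab by (simp_all add: f_def g_def unitary_mat_norm unitary_mat_mult unitary_mat_pauli)
  \<comment> \<open>With S the sum of the moduli this reads \<open>C_max U\<close> \<le> S^2 - 1,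
    because the squared moduli sum to 1; the extent is 2 S^2 - 1.\<close>
  ultimately have "C_max U \<le> (\<Sum>j\<le>3. cmod (?u j))\<^sup>2 - 1"
    using cmod_det_vec_comb_le [of f g ?u] by (simp add: ab(3) sum_cmod_pauli_coeff_power2)
  then show ?thesis by (simp add: extent_eq [OF c])
qed

section \<open>The two boundary families\<close>

lemma unitary_U_d: "unitary_mat (U_d x y z)"
proof -
  have "adjoint_mat (diag_mat d) ** diag_mat d = mat 1" if "\<And>k. cmod (d k) = 1" for d :: "2 \<times> 2 \<Rightarrow> complex"
  proof -
    have "cnj (d k) * d k = 1" for k
      using that[of k] by (metis complex_norm_square mult.commute of_real_1 one_power2)
    then show ?thesis
      by (auto simp: vec_eq_iff mult_diag_mat_nth) (auto simp: diag_mat_def mat_def)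
  qed
  then have "unitary_mat (diag_mat d)" if "\<And>k. cmod (d k) = 1" for d :: "2 \<times> 2 \<Rightarrow> complex"
    using that by (simp add: unitary_mat_def matrix_left_right_inverse)
  then show ?thesis
    unfolding U_d_magic
    by (intro unitary_mat_mult unitary_mat_adjoint unitary_magic) simp
qed

lemma pauli_comb_mult_vec_nth:
  "(pauli_comb u *v \<psi>) $ (1,1) = (u 0 + u 3) * \<psi> $ (1,1) + (u 1 - u 2) * \<psi> $ (2,2)"
  "(pauli_comb u *v \<psi>) $ (1,2) = (u 0 - u 3) * \<psi> $ (1,2) + (u 1 + u 2) * \<psi> $ (2,1)"
  "(pauli_comb u *v \<psi>) $ (2,1) = (u 1 + u 2) * \<psi> $ (1,2) + (u 0 - u 3) * \<psi> $ (2,1)"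
  "(pauli_comb u *v \<psi>) $ (2,2) = (u 1 - u 2) * \<psi> $ (1,1) + (u 0 + u 3) * \<psi> $ (2,2)"
  by (simp_all add: matrix_vector_mult_def sum_UNIV_2x2 pauli_comb_nth algebra_simps)

lemma cartan_form_U_d:
  "\<bar>z\<bar> \<le> y \<Longrightarrow> y \<le> x \<Longrightarrow> x \<le> pi / 4 \<Longrightarrow> cartan_form (U_d x y z) x y z"
  by (simp add: cartan_form_iff locally_equiv_refl)

text \<open>The input 00 is sent to cos x 00 + i sin x 11, of concurrence sin 2x. No other input
  does better, because the general inequality caps \<open>C_max\<close> at exactly this value once
  \<gamma> is known.\<close>

lemma C_max_extent_controlled:
  assumes "0 \<le> x" "x \<le> pi / 4"
  shows "C_max (U_d x 0 0) = sin (2 * x)" "\<gamma> (U_d x 0 0) = 1 + 2 * sin (2 * x)"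
proof -
  have sc: "0 \<le> sin x" "0 \<le> cos x"
    using assms by (auto intro!: sin_ge_zero cos_ge_zero)
  have form: "cartan_form (U_d x 0 0) x 0 0"
    using assms by (intro cartan_form_U_d) auto
  have "\<gamma> (U_d x 0 0) = 2 * (cos x + sin x)\<^sup>2 - 1"
    unfolding extent_eq [OF form] sum_atMost_3 using sc by (simp add: cmod_def)
  also have "\<dots> = 2 * ((cos x)\<^sup>2 + (sin x)\<^sup>2) - 1 + 4 * (sin x * cos x)"
    by algebra
  finally show \<gamma>: "\<gamma> (U_d x 0 0) = 1 + 2 * sin (2 * x)"
    by (simp add: sin_double)
  have "2 * cmod (det_vec (U_d x 0 0 *v (axis 1 1 \<otimes>\<^sub>v axis 1 1))) \<le> C_max (U_d x 0 0)"
    by (intro C_max_attained(2) unitary_U_d) (simp_all add: norm_axis_1)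
  moreover have "cmod (det_vec (U_d x 0 0 *v (axis 1 1 \<otimes>\<^sub>v axis 1 1))) = sin x * cos x"
    unfolding det_vec_def U_d_pauli_comb pauli_comb_mult_vec_nth
    using sc by (simp add: axis_def norm_mult cmod_def)
  ultimately have "sin (2 * x) \<le> C_max (U_d x 0 0)"
    by (simp add: sin_double)
  with C_max_le_extent [OF unitary_U_d form] show "C_max (U_d x 0 0) = sin (2 * x)"
    by (simp add: \<gamma>)
qed

text \<open>All coefficients have modulus 1/2, which is equality in Cauchy--Schwarz. Since
  \<open>?u 0 = ?u 3\<close> and \<open>?u 1 = ?u 2\<close>, the gate only multiplies the basis
  states by phases and exchanges 01 with 10, so the output determinant is a multiple of the product
  of the four input amplitudes.\<close>

lemma C_max_extent_iSWAP_SWAP: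
  assumes "0 \<le> z" "z \<le> pi / 4"
  shows "C_max (U_d (pi / 4) (pi / 4) z) = cos (2 * z)" "\<gamma> (U_d (pi / 4) (pi / 4) z) = 7"
proof -
  let ?u = "pauli_coeff (pi / 4) (pi / 4) z"
  have form: "cartan_form (U_d (pi / 4) (pi / 4) z) (pi / 4) (pi / 4) z"
    using assms by (intro cartan_form_U_d) auto
  have u: "?u 0 = cis z / 2" "?u 1 = \<i> * cis (- z) / 2" "?u 2 = \<i> * cis (- z) / 2" "?u 3 = cis z / 2"
    by (simp_all add: complex_eq_iff sin_45 cos_45)
  have "(\<Sum>j\<le>3. cmod (?u j)) = 2"
    unfolding sum_atMost_3 u by (simp add: norm_mult norm_divide)
  then show "\<gamma> (U_d (pi / 4) (pi / 4) z) = 7"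
    by (simp add: extent_eq [OF form])
  have cos: "0 \<le> cos (2 * z)" using assms by (intro cos_ge_zero) auto
  have det: "cmod (det_vec (U_d (pi / 4) (pi / 4) z *v (a \<otimes>\<^sub>v b)))
      = 2 * cos (2 * z) * (cmod (a $ 1) * cmod (a $ 2) * (cmod (b $ 1) * cmod (b $ 2)))" for a b
  proof -
    have "det_vec (U_d (pi / 4) (pi / 4) z *v (a \<otimes>\<^sub>v b))
        = (cis z * cis z + cis (- z) * cis (- z)) * (a $ 1 * a $ 2 * (b $ 1 * b $ 2))"
      unfolding det_vec_def U_d_pauli_comb pauli_comb_mult_vec_nth u
      by (simp add: algebra_simps)
    also have "cis z * cis z + cis (- z) * cis (- z) = of_real (2 * cos (2 * z))"
      by (simp add: cis_mult complex_eq_iff)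
    finally show ?thesis using cos by (simp add: norm_mult)
  qed
  have half: "cmod (a $ 1) * cmod (a $ 2) \<le> 1 / 2" if "norm a = 1" for a :: qubit
    using sum_squares_bound [of "cmod (a $ 1)" "cmod (a $ 2)"] norm_qubit [of a] that by simp
  \<comment> \<open>Equal amplitudes give equality in \<open>half\<close>, so this input is optimal
    on both qubits.\<close>
  define h :: qubit where "h = (\<chi> i. of_real (1 / sqrt 2))"
  have "norm h = 1"
    by (simp add: norm_vec_def L2_set_def sum_2 h_def norm_divide power_divide)
  show "C_max (U_d (pi / 4) (pi / 4) z) = cos (2 * z)"
  proof (rule C_max_eqI [OF unitary_U_d _ \<open>norm h = 1\<close> \<open>norm h = 1\<close>])
    fix a b :: qubit assume "norm a = 1" "norm b = 1"
    then have "cmod (a $ 1) * cmod (a $ 2) * (cmod (b $ 1) * cmod (b $ 2)) \<le> (1 / 2) * (1 / 2)"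
      by (intro mult_mono half) auto
    then have "4 * cos (2 * z) * (cmod (a $ 1) * cmod (a $ 2) * (cmod (b $ 1) * cmod (b $ 2)))
        \<le> 4 * cos (2 * z) * (1 / 4)"
      using cos by (intro mult_left_mono) auto
    then show "2 * cmod (det_vec (U_d (pi / 4) (pi / 4) z *v (a \<otimes>\<^sub>v b))) \<le> cos (2 * z)"
      unfolding det by simp
  next
    show "2 * cmod (det_vec (U_d (pi / 4) (pi / 4) z *v (h \<otimes>\<^sub>v h))) = cos (2 * z)"
      unfolding det by (simp add: h_def norm_divide)
  qed
qed

lemma attains_controlled: "attains (\<lambda>\<theta>. U_d \<theta> 0 0) (\<lambda>v. 1 + 2 * v)"
  unfolding attains_def
proof
  fix v :: real assume v: "v \<in> {0..1}"
  then have "arcsin v / 2 \<in> {0..pi / 4}"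
    using arcsin_le_arcsin [of 0 v] arcsin_bounded [of v] by auto
  with v show "\<exists>\<theta>\<in>{0..pi / 4}. C_max (U_d \<theta> 0 0) = v \<and> \<gamma> (U_d \<theta> 0 0) = 1 + 2 * v"
    by (intro bexI[of _ "arcsin v / 2"]) (simp_all add: C_max_extent_controlled)
qed

lemma attains_iSWAP_SWAP: "attains (\<lambda>\<theta>. U_d (pi / 4) (pi / 4) \<theta>) (\<lambda>v. 7)"
  unfolding attains_def
proof
  fix v :: real assume v: "v \<in> {0..1}"
  then have "arccos v / 2 \<in> {0..pi / 4}"
    using arccos_le_pi2 [of v] arccos_lbound [of v] by auto
  with v show "\<exists>\<theta>\<in>{0..pi / 4}. C_max (U_d (pi / 4) (pi / 4) \<theta>) = v \<and> \<gamma> (U_d (pi / 4) (pi / 4) \<theta>) = 7"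
    by (intro bexI[of _ "arccos v / 2"]) (simp_all add: C_max_extent_iSWAP_SWAP)
qed

section \<open>Unitary matrices and real orthonormal bases\<close>

definition cvec :: "real ^ 'n \<Rightarrow> complex ^ 'n" where
  "cvec x = (\<chi> i. of_real (x $ i))"

lemma cvec_nth [simp]: "cvec x $ i = of_real (x $ i)"
  by (simp add: cvec_def)

lemma unitary_mat_transpose:
  assumes "unitary_mat A"
  shows "unitary_mat (transpose A)"
proof -
  have "adjoint_mat (transpose A) = transpose (adjoint_mat A)"
    by (simp add: vec_eq_iff transpose_def)
  then show ?thesis
    using assms by (simp add: unitary_mat_def matrix_transpose_mul [symmetric] transpose_mat)
qed

lemma symmetric_unitary_eigenbasis:
  fixes M :: "complex ^ 'n::finite ^ 'n"
  assumes M: "unitary_mat M" "transpose M = M"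
  obtains e :: "'n \<Rightarrow> real ^ 'n" and \<mu>
  where "\<And>i j. e i \<bullet> e j = (if i = j then 1 else 0)"
    and "\<And>i. M *v cvec (e i) = \<mu> i *s cvec (e i)" "\<And>i. cmod (\<mu> i) = 1"
proof -
  define A :: "real ^ 'n ^ 'n" where "A = (\<chi> i j. Re (M $ i $ j))"
  define C :: "real ^ 'n ^ 'n" where "C = (\<chi> i j. Im (M $ i $ j))"
  have Mt: "M $ i $ j = M $ j $ i" for i j
    using arg_cong [OF M(2), of "\<lambda>A. A $ j $ i"] by (simp add: transpose_def)
  have sym: "(B *v x) \<bullet> y = x \<bullet> (B *v y)" if "transpose B = B" for B :: "real ^ 'n ^ 'n" and x y
    by (metis that dot_lmul_matrix vector_transpose_matrix)
  have At: "transpose A = A" "transpose C = C"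
    by (simp_all add: vec_eq_iff transpose_def A_def C_def Mt)
  have "A ** C = C ** A"
  proof -
    have "(A ** C) $ i $ j = (C ** A) $ i $ j" for i j
    proof -
      \<comment> \<open>By symmetry the adjoint of M = A + iC is A - iC, so the imaginary part of
        the product is CA - AC.\<close>
      have "(M ** adjoint_mat M) $ i $ j = (if i = j then 1 else 0)"
        using M by (simp add: unitary_matD mat_def)
      then have "Im (\<Sum>k\<in>UNIV. M $ i $ k * cnj (M $ k $ j)) = 0"
        by (simp add: matrix_matrix_mult_def Mt[of j] split: if_splits)
      then show ?thesis
        by (simp add: matrix_matrix_mult_def A_def C_def Im_sum sum_subtractf)
    qed
    then show ?thesis by (simp add: vec_eq_iff)
  qed
  then have comm: "A *v (C *v x) = C *v (A *v x)" for x
    by (simp add: matrix_vector_mul_assoc)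
  obtain e :: "'n \<Rightarrow> real ^ 'n" and a b
    where e: "\<And>i j. e i \<bullet> e j = (if i = j then 1 else 0)"
      and ab: "\<And>i. A *v e i = a i *\<^sub>R e i" "\<And>i. C *v e i = b i *\<^sub>R e i"
    by (rule commuting_selfadjoint_eigenbasis
        [OF matrix_vector_mul_linear sym [OF At(1)] matrix_vector_mul_linear sym [OF At(2)] comm])
      (blast intro: that)
  have "M *v cvec x = (\<chi> i. Complex ((A *v x) $ i) ((C *v x) $ i))" for x
    by (simp add: vec_eq_iff complex_eq_iff matrix_vector_mult_def A_def C_def)
  then have \<mu>: "M *v cvec (e i) = Complex (a i) (b i) *s cvec (e i)" for i
    by (simp add: ab vec_eq_iff complex_eq_iff)
  have "cmod (Complex (a i) (b i)) = 1" for i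
  proof -
    have "norm (cvec (e i)) = norm (e i)"
      by (simp add: norm_vec_def)
    then have 1: "norm (cvec (e i)) = 1"
      using e[of i i] by (simp add: norm_eq_1)
    have "norm (c *s v) = cmod c * norm v" for c and v :: "complex ^ 'n"
      by (simp add: norm_vec_def norm_mult L2_set_right_distrib)
    with 1 unitary_mat_norm [OF M(1), of "cvec (e i)"] show ?thesis
      by (simp add: \<mu>)
  qed
  with e \<mu> show ?thesis by (intro that)
qed

text \<open>The basis \<open>e\<close> diagonalises \<open>transpose N ** N\<close>; the images are real because a vector \<open>g\<close> with
  $g^T g = g^\dagger g$ is real.\<close>

lemma unitary_real_bases:
  fixes N :: "complex ^ 'n::finite ^ 'n"
  assumes N: "unitary_mat N"
  obtains e f :: "'n \<Rightarrow> real ^ 'n" and d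
  where "\<forall>i j. e i \<bullet> e j = (if i = j then 1 else 0)" "\<forall>i j. f i \<bullet> f j = (if i = j then 1 else 0)"
    and "\<forall>i. N *v cvec (e i) = d i *s cvec (f i)" "\<forall>i. cmod (d i) = 1"
proof -
  let ?M = "transpose N ** N"
  have "unitary_mat ?M" "transpose ?M = ?M"
    using N by (simp_all add: unitary_mat_mult unitary_mat_transpose matrix_transpose_mul)
  then obtain e :: "'n \<Rightarrow> real ^ 'n" and \<mu>
    where e: "\<And>i j. e i \<bullet> e j = (if i = j then 1 else 0)"
    and \<mu>: "\<And>i. ?M *v cvec (e i) = \<mu> i *s cvec (e i)" "\<And>i. cmod (\<mu> i) = 1"
    using symmetric_unitary_eigenbasis by blast
  \<comment> \<open>Either square root would serve: dividing by \<open>d i\<close> makes the images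
    orthonormal for the bilinear form without conjugation, as \<open>d i * d i\<close> cancels the
    eigenvalue.\<close>
  define d where "d i = csqrt (\<mu> i)" for i
  have d: "cmod (d i) = 1" "d i * d i = \<mu> i" for i
    using \<mu>(2) [of i] by (simp_all add: d_def norm_csqrt flip: power2_eq_square)
  then have d0: "d i \<noteq> 0" for i by (metis norm_zero zero_neq_one)
  define g where "g i = inverse (d i) *s (N *v cvec (e i))" for i
  have cc: "(\<Sum>k\<in>UNIV. cvec (e i) $ k * cvec (e j) $ k) = (if i = j then 1 else 0)" for i j
  proof -
    have "(\<Sum>k\<in>UNIV. cvec (e i) $ k * cvec (e j) $ k) = of_real (e i \<bullet> e j)"
      by (simp add: inner_vec_def)
    then show ?thesis by (simp add: e)
  qed
  have bil: "(\<Sum>k\<in>UNIV. (N *v x) $ k * (N *v y) $ k) = (\<Sum>k\<in>UNIV. x $ k * (?M *v y) $ k)" for x y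
  proof -
    have "(\<Sum>k\<in>UNIV. (N *v x) $ k * z $ k) = (\<Sum>k\<in>UNIV. x $ k * (transpose N *v z) $ k)" for z
      unfolding matrix_vector_mult_def transpose_def
      by (simp add: sum_distrib_left sum_distrib_right mult_ac) (rule sum.swap)
    then show ?thesis by (simp add: matrix_vector_mul_assoc [symmetric])
  qed
  have gg: "(\<Sum>k\<in>UNIV. g i $ k * g j $ k) = (if i = j then 1 else 0)" for i j
  proof -
    have "(\<Sum>k\<in>UNIV. g i $ k * g j $ k)
        = inverse (d i) * inverse (d j) * (\<Sum>k\<in>UNIV. (N *v cvec (e i)) $ k * (N *v cvec (e j)) $ k)"
      by (simp add: g_def sum_distrib_left mult_ac)
    also have "\<dots> = inverse (d i) * inverse (d j) * (\<mu> j * (\<Sum>k\<in>UNIV. cvec (e i) $ k * cvec (e j) $ k))"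
      unfolding bil \<mu> by (simp add: sum_distrib_left mult_ac)
    also have "\<dots> = (if i = j then 1 else 0)"
      unfolding cc using d0[of j] by (simp add: d(2) [symmetric] field_simps)
    finally show ?thesis .
  qed
  have norm_g: "(norm (g i))\<^sup>2 = 1" for i
  proof -
    have "norm (c *s v) = cmod c * norm v" for c and v :: "complex ^ 'n"
      by (simp add: norm_vec_def norm_mult L2_set_right_distrib)
    moreover have "norm (cvec (e i)) = norm (e i)"
      by (simp add: norm_vec_def)
    moreover have "norm (e i) = 1" using e[of i i] by (simp add: norm_eq_1)
    ultimately show ?thesis
      by (simp add: g_def norm_inverse d(1) unitary_mat_norm [OF N])
  qed
  have Im_g: "Im (g i $ k) = 0" for i k
  proof -
    have "(\<Sum>k\<in>UNIV. (Re (g i $ k))\<^sup>2 - (Im (g i $ k))\<^sup>2) = 1"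
      using arg_cong [OF gg [of i i], of Re] by (simp add: power2_eq_square)
    moreover have "(\<Sum>k\<in>UNIV. (Re (g i $ k))\<^sup>2 + (Im (g i $ k))\<^sup>2) = 1"
      using norm_g[of i] by (simp add: norm_vec_power2 cmod_power2)
    ultimately have "(\<Sum>k\<in>UNIV. (Im (g i $ k))\<^sup>2) = 0"
      by (simp add: sum.distrib sum_subtractf)
    then show ?thesis by (simp add: sum_nonneg_eq_0_iff)
  qed
  define f :: "'n \<Rightarrow> real ^ 'n" where "f i = (\<chi> k. Re (g i $ k))" for i
  have "cvec (f i) = g i" for i
    by (simp add: vec_eq_iff complex_eq_iff f_def Im_g)
  then have "N *v cvec (e i) = d i *s cvec (f i)" for i
    using d0[of i] by (simp add: g_def vec_eq_iff)
  moreover have "f i \<bullet> f j = (if i = j then 1 else 0)" for i j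
    using arg_cong [OF gg [of i j], of Re] by (simp add: inner_vec_def f_def Im_g split: if_splits)
  ultimately show ?thesis using e d(1) by (intro that allI)
qed

text \<open>The combination of I, iX, iY, iZ with the coordinates of \<open>x\<close>, in the order
  of the columns of \<open>magic\<close>: the usual matrix model of the real quaternions.\<close>

definition quat :: "real ^ (2 \<times> 2) \<Rightarrow> gate1" where
  "quat x = vector [vector [Complex (x $ (1,1)) (x $ (2,2)), Complex (x $ (2,1)) (x $ (1,2))],
                    vector [Complex (- x $ (2,1)) (x $ (1,2)), Complex (x $ (1,1)) (- x $ (2,2))]]"

lemma quat_nth [simp]:
  "quat x $ 1 $ 1 = Complex (x $ (1,1)) (x $ (2,2))" "quat x $ 1 $ 2 = Complex (x $ (2,1)) (x $ (1,2))"
  "quat x $ 2 $ 1 = Complex (- x $ (2,1)) (x $ (1,2))" "quat x $ 2 $ 2 = Complex (x $ (1,1)) (- x $ (2,2))"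
  by (simp_all add: quat_def)

lemma magic_cvec_nth: "(magic *v cvec x) $ i = of_real (1 / sqrt 2) * quat x $ fst i $ snd i"
proof -
  have "\<forall>i. (magic *v cvec x) $ i = of_real (1 / sqrt 2) * quat x $ fst i $ snd i"
    unfolding forall_2x2 matrix_vector_mult_def
    by (simp add: sum_UNIV_2x2 magic_nth complex_eq_iff field_simps)
  then show ?thesis by blast
qed

text \<open>On coefficient matrices a local gate multiplies by \<open>V\<close> from the left and by
  the transpose of \<open>W\<close> from the right, which on quaternions is left and right
  multiplication.\<close>

lemma kron_mult_vec_nth:
  "((V \<otimes>\<^sub>m W) *v \<psi>) $ i = (V ** (\<chi> i j. \<psi> $ (i,j)) ** transpose W) $ fst i $ snd i"
  by (simp add: matrix_vector_mult_def matrix_matrix_mult_def transpose_def sum_UNIV_2x2 sum_2 algebra_simps)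

definition is_quat :: "gate1 \<Rightarrow> bool" where
  "is_quat A \<longleftrightarrow> A $ 2 $ 2 = cnj (A $ 1 $ 1) \<and> A $ 2 $ 1 = - cnj (A $ 1 $ 2)"

lemma is_quat_quat: "is_quat (quat x)"
  by (simp add: is_quat_def complex_eq_iff)

lemma is_quat_mult: "is_quat A \<Longrightarrow> is_quat B \<Longrightarrow> is_quat (A ** B)"
  by (simp add: is_quat_def matrix_matrix_mult_def sum_2)

lemma is_quat_adjoint: "is_quat A \<Longrightarrow> is_quat (adjoint_mat A)"
  by (simp add: is_quat_def)

text \<open>The polarised quaternion norm. Orthogonality of real vectors thereby becomes an
  anticommutation relation.\<close>

lemma quat_polar:
  "adjoint_mat (quat x) ** quat y + adjoint_mat (quat y) ** quat x = (2 * (x \<bullet> y)) *\<^sub>R mat 1"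
  by (simp add: vec2_eq_iff matrix_matrix_mult_def sum_2 mat_def inner_vec_def sum_UNIV_2x2
      complex_eq_iff algebra_simps)

lemma mat_minus_mult:
  fixes A B C :: "'a::comm_ring_1 ^ 'n::finite ^ 'n"
  shows "(A - B) ** C = A ** C - B ** C" "C ** (A - B) = C ** A - C ** B"
    "(- A) ** C = - (A ** C)" "C ** (- A) = - (C ** A)"
  by (simp_all add: vec_eq_iff matrix_matrix_mult_def left_diff_distrib right_diff_distrib
      sum_subtractf sum_negf)

lemma scaleR_matrix_mult:
  fixes A B :: "complex ^ 'n::finite ^ 'n"
  shows "(r *\<^sub>R A) ** B = r *\<^sub>R (A ** B)" "A ** (r *\<^sub>R B) = r *\<^sub>R (A ** B)"
  by (simp_all add: vec_eq_iff matrix_matrix_mult_def scaleR_sum_right)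

text \<open>Two imaginary unit quaternions are conjugate up to a sign: \<open>R ** K = K ** S\<close> holds
  for \<open>K = mat 1 - R ** S\<close>, which vanishes only if \<open>R = - S\<close>.\<close>

lemma imaginary_quat_conjugate:
  assumes q: "is_quat R" "is_quat S" and R: "R ** R = - mat 1" and S: "S ** S = - mat 1"
  obtains K and s :: real where "unitary_mat K" "is_quat K" "s = 1 \<or> s = -1" "R ** K = s *\<^sub>R (K ** S)"
    "\<forall>T. T ** R = - (R ** T) \<longrightarrow> T ** S = - (S ** T) \<longrightarrow> T ** K = K ** T"
proof (cases "R = - S")
  case True
  moreover have "is_quat (mat 1)" by (simp add: is_quat_def mat_def)
  ultimately show ?thesis
    by (intro that[of "mat 1" "-1"]) (simp_all add: unitary_mat_mat_1)
next
  case False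
  define L where "L = mat 1 - R ** S"
  have L: "is_quat L"
    using is_quat_mult [OF q] by (simp add: L_def is_quat_def mat_def)
  have RL: "R ** L = L ** S"
    by (simp add: L_def mat_minus_mult matrix_mul_assoc R)
      (simp add: matrix_mul_assoc [symmetric] S mat_minus_mult)
  \<comment> \<open>Such a \<open>T\<close> commutes with \<open>R ** S\<close>, the sign being
    changed twice, and hence with \<open>L\<close>. When a second axis is aligned, this keeps the
    first one in place.\<close>
  have TL: "T ** L = L ** T" if "T ** R = - (R ** T)" "T ** S = - (S ** T)" for T
  proof -
    have "T ** (R ** S) = (R ** S) ** T"
      by (simp add: matrix_mul_assoc that(1) mat_minus_mult)
        (simp add: matrix_mul_assoc [symmetric] that(2) mat_minus_mult)
    then show ?thesis by (simp add: L_def mat_minus_mult)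
  qed
  \<comment> \<open>The quaternion norm of \<open>L\<close>, equal to its determinant; dividing by
    its square root makes \<open>L\<close> unitary.\<close>
  define c where "c = (cmod (L $ 1 $ 1))\<^sup>2 + (cmod (L $ 1 $ 2))\<^sup>2"
  have "L \<noteq> 0"
  proof
    assume "L = 0"
    then have "mat 1 ** S = (R ** S) ** S" by (simp add: L_def)
    then have "S = - R" by (simp add: matrix_mul_assoc [symmetric] S mat_minus_mult)
    with False show False by simp
  qed
  then have "L $ 1 $ 1 \<noteq> 0 \<or> L $ 1 $ 2 \<noteq> 0"
    using L by (auto simp: vec2_eq_iff is_quat_def)
  then have "c > 0"
    by (auto simp: c_def add_pos_nonneg add_nonneg_pos)
  have "adjoint_mat L ** L = c *\<^sub>R mat 1"
  proof -
    have "complex_of_real c = L $ 1 $ 1 * cnj (L $ 1 $ 1) + L $ 1 $ 2 * cnj (L $ 1 $ 2)"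
      unfolding c_def of_real_add complex_norm_square ..
    then show ?thesis
      using L by (simp add: vec2_eq_iff matrix_matrix_mult_def sum_2 mat_def is_quat_def
        of_real_def [symmetric] algebra_simps)
  qed
  then have "adjoint_mat (inverse (sqrt c) *\<^sub>R L) ** (inverse (sqrt c) *\<^sub>R L) = mat 1"
  proof -
    have "adjoint_mat (inverse (sqrt c) *\<^sub>R L) = inverse (sqrt c) *\<^sub>R adjoint_mat L"
      by (simp add: vec_eq_iff)
    moreover have "inverse (sqrt c) * (inverse (sqrt c) * c) = 1"
      using \<open>c > 0\<close> by (simp add: field_simps)
    ultimately show ?thesis
      using \<open>adjoint_mat L ** L = c *\<^sub>R mat 1\<close> by (simp add: scaleR_matrix_mult)
  qed
  then have "unitary_mat (inverse (sqrt c) *\<^sub>R L)"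
    by (simp add: unitary_mat_def matrix_left_right_inverse)
  then show ?thesis
    using L RL TL
    by (intro that[of "inverse (sqrt c) *\<^sub>R L" 1]) (simp_all add: is_quat_def scaleR_matrix_mult)
qed

section \<open>Existence of the Cartan form\<close>

lemma quat_axis_1: "quat (axis (1,1) 1) = mat 1"
  by (simp add: vec2_eq_iff mat_def axis_def complex_eq_iff)

text \<open>Anticommuting with iX and iY removes the components of \<open>T\<close> along I, iX and
  iY; the square then fixes the remaining one up to sign.\<close>

lemma quat_anticommute_axes:
  assumes T: "is_quat T" "T ** T = - mat 1"
    and anti: "T ** quat (axis (1,2) 1) = - (quat (axis (1,2) 1) ** T)"
      "T ** quat (axis (2,1) 1) = - (quat (axis (2,1) 1) ** T)"
  obtains s :: real where "s = 1 \<or> s = -1" "T = s *\<^sub>R quat (axis (2,2) 1)"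
proof -
  have T2: "T $ 2 $ 2 = cnj (T $ 1 $ 1)" "T $ 2 $ 1 = - cnj (T $ 1 $ 2)"
    using T(1) by (simp_all add: is_quat_def)
  have "Re (T $ 1 $ 1) = 0" "Re (T $ 1 $ 2) = 0" "Im (T $ 1 $ 2) = 0"
    using anti by (simp_all add: vec2_eq_iff matrix_matrix_mult_def sum_2 axis_def complex_eq_iff T2)
  then have T1: "T $ 1 $ 2 = 0" "T $ 1 $ 1 = \<i> * of_real (Im (T $ 1 $ 1))"
    by (simp_all add: complex_eq_iff)
  have "(T ** T) $ 1 $ 1 = -1" using T(2) by (simp add: mat_def)
  then have "(Im (T $ 1 $ 1))\<^sup>2 = 1"
    using \<open>Re (T $ 1 $ 1) = 0\<close>
    by (simp add: matrix_matrix_mult_def sum_2 T1(1) complex_eq_iff power2_eq_square)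
  then have "Im (T $ 1 $ 1) = 1 \<or> Im (T $ 1 $ 1) = -1"
    by (simp add: power2_eq_1_iff)
  moreover have "T = Im (T $ 1 $ 1) *\<^sub>R quat (axis (2,2) 1)"
    using \<open>Re (T $ 1 $ 1) = 0\<close> by (simp add: vec2_eq_iff T2 T1(1) axis_def complex_eq_iff)
  ultimately show ?thesis by (intro that)
qed

text \<open>Multiplying by the conjugate of the first frame element moves it to 1. Orthogonality to
  1 then makes the other three purely imaginary, and orthogonality among them makes them
  anticommute.\<close>

lemma frame_relations:
  assumes e: "\<And>i j. e i \<bullet> e j = (if i = j then 1 else 0)"
  defines "R \<equiv> \<lambda>k. adjoint_mat (quat (e (1,1))) ** quat (e k)"
  shows "unitary_mat (quat (e k))" "R (1,1) = mat 1"
    and "k \<noteq> (1,1) \<Longrightarrow> R k ** R k = - mat 1"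
    and "j \<noteq> (1,1) \<Longrightarrow> k \<noteq> (1,1) \<Longrightarrow> j \<noteq> k \<Longrightarrow> R j ** R k = - (R k ** R j)"
proof -
  have Q: "adjoint_mat (quat (e k)) ** quat (e k) = mat 1" for k
  proof -
    have "2 *\<^sub>R (adjoint_mat (quat (e k)) ** quat (e k)) = 2 *\<^sub>R mat 1"
      using quat_polar [of "e k" "e k"] by (simp add: e scaleR_2)
    then show ?thesis by simp
  qed
  then show un: "unitary_mat (quat (e k))" for k
    by (simp add: unitary_mat_def matrix_left_right_inverse)
  show "R (1,1) = mat 1" by (simp add: R_def Q)
  have anti: "adjoint_mat (quat (e j)) ** quat (e k) = - (adjoint_mat (quat (e k)) ** quat (e j))"
    if "j \<noteq> k" for j k
    using quat_polar [of "e j" "e k"] that by (simp add: e eq_neg_iff_add_eq_0)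
  have skew: "R k = - adjoint_mat (R k)" if "k \<noteq> (1,1)" for k
  proof -
    have "adjoint_mat (R k) = adjoint_mat (quat (e k)) ** quat (e (1,1))"
      by (simp add: R_def adjoint_mat_mult)
    then show ?thesis
      using anti [of "(1,1)" k] that by (simp add: R_def)
  qed
  have RR: "adjoint_mat (R j) ** R k = adjoint_mat (quat (e j)) ** quat (e k)" for j k
  proof -
    have "adjoint_mat (R j) ** R k
      = adjoint_mat (quat (e j)) ** (quat (e (1,1)) ** adjoint_mat (quat (e (1,1)))) ** quat (e k)"
      by (simp add: R_def adjoint_mat_mult matrix_mul_assoc)
    then show ?thesis using un by (simp add: unitary_matD)
  qed
  have neg: "R j ** R k = - (adjoint_mat (R j) ** R k)" if "j \<noteq> (1,1)" for j k
    using skew [OF that] by (metis mat_minus_mult(3))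
  show "R k ** R k = - mat 1" if "k \<noteq> (1,1)"
    using that by (simp add: neg RR Q)
  show "R j ** R k = - (R k ** R j)" if "j \<noteq> (1,1)" "k \<noteq> (1,1)" "j \<noteq> k"
    using that anti[of j k] by (simp add: neg RR)
qed

text \<open>Conjugation by unit quaternions rotates the imaginary space: \<open>K1\<close> aligns
  one element with iX up to sign, \<open>K2\<close> a second one with iY, and the third is then
  forced onto the line of iZ. The signs cannot all be dispensed with, since a rotation does not turn
  a left-handed frame into a right-handed one.\<close>

lemma quat_frame_conjugate:
  fixes R :: "2 \<times> 2 \<Rightarrow> gate1"
  assumes R: "\<And>k. is_quat (R k)" "R (1,1) = mat 1" "\<And>k. k \<noteq> (1,1) \<Longrightarrow> R k ** R k = - mat 1"
    "\<And>j k. j \<noteq> (1,1) \<Longrightarrow> k \<noteq> (1,1) \<Longrightarrow> j \<noteq> k \<Longrightarrow> R j ** R k = - (R k ** R j)"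
  obtains K and s :: "2 \<times> 2 \<Rightarrow> real" where "unitary_mat K" "\<forall>k. s k = 1 \<or> s k = -1"
    "\<forall>k. R k ** K = s k *\<^sub>R (K ** quat (axis k 1))"
proof -
  let ?E = "\<lambda>k. quat (axis k 1)"
  have ax: "axis i 1 \<bullet> axis j (1::real) = (if i = j then 1 else 0)" for i j :: "2 \<times> 2"
    by (simp add: inner_axis_axis)
  have E: "is_quat (?E k)" for k :: "2 \<times> 2"
    by (rule is_quat_quat)
  have E_sq: "?E k ** ?E k = - mat 1" if "k \<noteq> (1,1)" for k :: "2 \<times> 2"
    using frame_relations(3) [of "\<lambda>k. axis k 1", OF ax that]
    by (simp only: quat_axis_1 adjoint_mat_mat_1 matrix_mul_lid)
  have E_anti: "?E j ** ?E k = - (?E k ** ?E j)" if "j \<noteq> (1,1)" "k \<noteq> (1,1)" "j \<noteq> k" for j k :: "2 \<times> 2"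
    using frame_relations(4) [of "\<lambda>k. axis k 1", OF ax that]
    by (simp only: quat_axis_1 adjoint_mat_mat_1 matrix_mul_lid)
  have R12: "R (1,2) ** R (1,2) = - mat 1" and E12: "?E (1,2) ** ?E (1,2) = - mat 1"
    and E21: "?E (2,1) ** ?E (2,1) = - mat 1"
    by (rule R(3) E_sq; simp)+
  obtain K1 and s1 :: real where K1: "unitary_mat K1" "is_quat K1" "s1 = 1 \<or> s1 = -1"
    "R (1,2) ** K1 = s1 *\<^sub>R (K1 ** ?E (1,2))"
    by (rule imaginary_quat_conjugate [OF R(1) E R12 E12]) (rule that)
  have s1: "s1 *\<^sub>R s1 *\<^sub>R A = A" for A :: gate1 using K1(3) by auto
  define P where "P k = adjoint_mat K1 ** R k ** K1" for k
  have PP: "P j ** P k = adjoint_mat K1 ** (R j ** R k) ** K1" for j k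
  proof -
    have "P j ** P k = adjoint_mat K1 ** R j ** (K1 ** adjoint_mat K1) ** R k ** K1"
      by (simp only: P_def matrix_mul_assoc)
    then show ?thesis using K1(1) by (simp add: unitary_matD matrix_mul_assoc)
  qed
  have P_quat: "is_quat (P k)" for k
    by (simp add: P_def is_quat_mult is_quat_adjoint K1 R(1))
  have P_sq: "P k ** P k = - mat 1" if "k \<noteq> (1,1)" for k
    using R(3) [OF that] K1(1) by (simp add: PP mat_minus_mult unitary_matD)
  have P_anti: "P j ** P k = - (P k ** P j)" if "j \<noteq> (1,1)" "k \<noteq> (1,1)" "j \<noteq> k" for j k
    using R(4) [OF that] by (simp add: PP mat_minus_mult)
  have "P (1,2) = s1 *\<^sub>R ?E (1,2)"
    using K1(1) by (simp add: P_def matrix_mul_assoc [symmetric] K1(4) scaleR_matrix_mult)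
      (simp add: matrix_mul_assoc unitary_matD)
  then have E1: "?E (1,2) = s1 *\<^sub>R P (1,2)" by (simp only: s1)
  have E1_anti: "P k ** ?E (1,2) = - (?E (1,2) ** P k)" if "k \<noteq> (1,1)" "k \<noteq> (1,2)" for k
    unfolding E1 scaleR_matrix_mult using P_anti [of k "(1,2)"] that by simp
  have P21: "P (2,1) ** P (2,1) = - mat 1"
    by (rule P_sq) simp
  obtain K2 and s2 :: real where K2: "unitary_mat K2" "is_quat K2" "s2 = 1 \<or> s2 = -1"
    "P (2,1) ** K2 = s2 *\<^sub>R (K2 ** ?E (2,1))"
    and K2_comm: "\<forall>T. T ** P (2,1) = - (P (2,1) ** T) \<longrightarrow> T ** ?E (2,1) = - (?E (2,1) ** T)
      \<longrightarrow> T ** K2 = K2 ** T"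
    by (rule imaginary_quat_conjugate [OF P_quat E P21 E21])
  have s2: "s2 * s2 = 1" using K2(3) by auto
  \<comment> \<open>The axis iX anticommutes with both \<open>P (2,1)\<close> and iY, so it commutes
    with \<open>K2\<close>: the second rotation preserves the first alignment.\<close>
  have E1_K2: "?E (1,2) ** K2 = K2 ** ?E (1,2)"
    using E1_anti [of "(2,1)"] E_anti [of "(1,2)" "(2,1)"] by (intro K2_comm [rule_format]) simp_all
  \<comment> \<open>The third imaginary unit after both rotations; it anticommutes with iX and
    iY.\<close>
  define T where "T = adjoint_mat K2 ** P (2,2) ** K2"
  have "T ** T = adjoint_mat K2 ** P (2,2) ** (K2 ** adjoint_mat K2) ** P (2,2) ** K2"
    by (simp only: T_def matrix_mul_assoc)
  also have "\<dots> = adjoint_mat K2 ** (P (2,2) ** P (2,2)) ** K2"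
    using K2(1) by (simp add: unitary_matD matrix_mul_assoc)
  finally have TT: "T ** T = - mat 1"
    using P_sq [of "(2,2)"] K2(1) by (simp add: mat_minus_mult unitary_matD)
  have conj: "adjoint_mat K2 ** A ** K2 = B" if "A ** K2 = K2 ** B" for A B
    using that K2(1) by (simp add: matrix_mul_assoc [symmetric]) (simp add: matrix_mul_assoc unitary_matD)
  have T_anti: "T ** B = - (B ** T)"
    if "A ** K2 = K2 ** B" "P (2,2) ** A = - (A ** P (2,2))" for A B
  proof -
    have "T ** B = adjoint_mat K2 ** P (2,2) ** (K2 ** adjoint_mat K2) ** A ** K2"
      "B ** T = adjoint_mat K2 ** A ** (K2 ** adjoint_mat K2) ** P (2,2) ** K2"
      by (simp_all only: T_def conj [OF that(1), symmetric] matrix_mul_assoc)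
    then have "T ** B = adjoint_mat K2 ** (P (2,2) ** A) ** K2"
      "B ** T = adjoint_mat K2 ** (A ** P (2,2)) ** K2"
      using K2(1) by (simp_all add: unitary_matD matrix_mul_assoc)
    then show ?thesis by (simp add: that(2) mat_minus_mult)
  qed
  have T1: "T ** ?E (1,2) = - (?E (1,2) ** T)"
    using E1_K2 E1_anti [of "(2,2)"] by (intro T_anti) simp_all
  have T2: "T ** ?E (2,1) = - (?E (2,1) ** T)"
  proof (rule T_anti)
    show "(s2 *\<^sub>R P (2,1)) ** K2 = K2 ** ?E (2,1)"
      by (simp add: scaleR_matrix_mult K2(4) s2)
    show "P (2,2) ** (s2 *\<^sub>R P (2,1)) = - ((s2 *\<^sub>R P (2,1)) ** P (2,2))"
      using P_anti [of "(2,2)" "(2,1)"] by (simp add: scaleR_matrix_mult)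
  qed
  have "is_quat T"
    by (simp add: T_def is_quat_mult is_quat_adjoint K2 P_quat)
  then obtain s3 :: real where s3: "s3 = 1 \<or> s3 = -1" "T = s3 *\<^sub>R ?E (2,2)"
    using TT T1 T2 by (rule quat_anticommute_axes)
  have P3: "P (2,2) ** K2 = K2 ** T"
    using K2(1) by (simp add: T_def matrix_mul_assoc unitary_matD)
  have K1P: "R k ** K1 = K1 ** P k" for k
    using K1(1) by (simp add: P_def matrix_mul_assoc unitary_matD)
  have RK: "R k ** (K1 ** K2) = K1 ** (P k ** K2)" for k
    by (simp add: matrix_mul_assoc K1P)
  define s where "s k = (if k = (1,1) then 1 else if k = (1,2) then s1 else if k = (2,1) then s2 else s3)"
    for k :: "2 \<times> 2"
  have "\<forall>k. R k ** (K1 ** K2) = s k *\<^sub>R ((K1 ** K2) ** ?E k)"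
    unfolding forall_2x2
  proof (intro conjI)
    show "R (1,1) ** (K1 ** K2) = s (1,1) *\<^sub>R ((K1 ** K2) ** ?E (1,1))"
      by (simp add: s_def R(2) quat_axis_1)
    show "R (1,2) ** (K1 ** K2) = s (1,2) *\<^sub>R ((K1 ** K2) ** ?E (1,2))"
      by (simp add: s_def matrix_mul_assoc K1(4) scaleR_matrix_mult)
        (simp add: matrix_mul_assoc [symmetric] E1_K2)
    show "R (2,1) ** (K1 ** K2) = s (2,1) *\<^sub>R ((K1 ** K2) ** ?E (2,1))"
      unfolding RK K2(4) by (simp add: s_def scaleR_matrix_mult matrix_mul_assoc)
    show "R (2,2) ** (K1 ** K2) = s (2,2) *\<^sub>R ((K1 ** K2) ** ?E (2,2))"
      unfolding RK P3 s3(2) by (simp add: s_def scaleR_matrix_mult matrix_mul_assoc)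
  qed
  then have "R k ** (K1 ** K2) = s k *\<^sub>R ((K1 ** K2) ** ?E k)" for k by blast
  moreover have "s k = 1 \<or> s k = -1" for k
    using K1(3) K2(3) s3(1) by (simp add: s_def)
  ultimately show ?thesis
    using K1(1) K2(1) by (intro that[of "K1 ** K2" s] unitary_mat_mult allI)
qed

text \<open>The double cover of SO(4) by pairs of unit quaternions, with signs to reach all of
  O(4).\<close>

lemma real_frame_local:
  assumes e: "\<And>i j. e i \<bullet> e j = (if i = j then 1 else 0)"
  obtains V W and s :: "2 \<times> 2 \<Rightarrow> real" where "unitary_mat V" "unitary_mat W" "\<forall>k. s k = 1 \<or> s k = -1"
    "\<forall>k. magic *v cvec (e k) = of_real (s k) *s ((V \<otimes>\<^sub>m W) *v (magic *v axis k 1))"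
proof -
  let ?Q = "quat (e (1,1))" and ?E = "\<lambda>k. quat (axis k 1)"
  let ?R = "\<lambda>k. adjoint_mat ?Q ** quat (e k)"
  note fr = frame_relations [of e, OF e]
  have "is_quat (?R k)" for k
    by (simp add: is_quat_mult is_quat_adjoint is_quat_quat)
  then obtain K and s :: "2 \<times> 2 \<Rightarrow> real" where K: "unitary_mat K" "\<forall>k. s k = 1 \<or> s k = -1"
    "\<forall>k. ?R k ** K = s k *\<^sub>R (K ** ?E k)"
    by (rule quat_frame_conjugate [of ?R, OF _ fr(2-4)])
  \<comment> \<open>From Q^* q K = s K E one gets q = s (Q K) E K^*. The right factor K^* has to be
    the transpose of \<open>?W\<close>, because the second qubit acts by right multiplication with a
    transpose.\<close>
  let ?V = "?Q ** K" and ?W = "transpose (adjoint_mat K)"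
  have un: "unitary_mat ?V" "unitary_mat ?W"
    using K(1) fr(1) by (simp_all add: unitary_mat_mult unitary_mat_adjoint unitary_mat_transpose)
  have q: "quat (e k) = s k *\<^sub>R (?V ** ?E k ** transpose ?W)" for k
  proof -
    have "quat (e k) = (?Q ** adjoint_mat ?Q) ** quat (e k) ** (K ** adjoint_mat K)"
      using K(1) fr(1) by (simp add: unitary_matD)
    also have "\<dots> = ?Q ** (?R k ** K) ** adjoint_mat K"
      by (simp only: matrix_mul_assoc)
    finally show ?thesis
      by (simp add: K(3) [rule_format] scaleR_matrix_mult matrix_mul_assoc)
  qed
  have "cvec (axis k 1) = axis k 1" for k :: "2 \<times> 2"
    by (simp add: vec_eq_iff axis_def)
  then have m: "(magic *v axis k 1) $ i = of_real (1 / sqrt 2) * ?E k $ fst i $ snd i" for i k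
    using magic_cvec_nth [of "axis k 1"] by simp
  have VW: "((?V \<otimes>\<^sub>m ?W) *v (magic *v axis k 1)) $ i
      = of_real (1 / sqrt 2) * (?V ** ?E k ** transpose ?W) $ fst i $ snd i" for i k
  proof -
    have "(\<chi> i j. (magic *v axis k 1) $ (i,j)) = cscale (of_real (1 / sqrt 2)) (?E k)"
      by (simp add: vec_eq_iff m)
    then show ?thesis
      by (simp only: kron_mult_vec_nth cscale_mult_left cscale_mult_right cscale_nth)
  qed
  have "(magic *v cvec (e k)) $ i = (of_real (s k) *s ((?V \<otimes>\<^sub>m ?W) *v (magic *v axis k 1))) $ i" for i k
    unfolding magic_cvec_nth vector_smult_component VW
    by (subst q) (simp only: scaleR_nth_nth mult.left_commute)
  then have "magic *v cvec (e k) = of_real (s k) *s ((?V \<otimes>\<^sub>m ?W) *v (magic *v axis k 1))" for k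
    by (simp add: vec_eq_iff)
  then show ?thesis
    by (rule that [OF un K(2) allI])
qed

lemma magic_diag_phase:
  assumes "\<And>k. cmod (c k) = 1"
  obtains w x y z where "cmod w = 1"
    "magic ** diag_mat c ** adjoint_mat magic = cscale w (U_d x y z)"
proof -
  define \<alpha> where "\<alpha> k = Arg (c k)" for k
  have c: "c k = exp (\<i> * of_real (\<alpha> k))" for k
    unfolding \<alpha>_def by (metis Arg_eq assms mult_1 norm_zero of_real_1 zero_neq_one)
  \<comment> \<open>The sign patterns of \<open>t\<close>, \<open>x\<close>, \<open>y\<close>,
    \<open>z\<close> in the four phases are the columns of a Hadamard matrix, so the system is
    inverted by its transpose divided by 4.\<close>
  define t where "t = (\<alpha> (1,1) + \<alpha> (1,2) + \<alpha> (2,1) + \<alpha> (2,2)) / 4"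
  define x where "x = (\<alpha> (1,1) + \<alpha> (1,2) - \<alpha> (2,1) - \<alpha> (2,2)) / 4"
  define y where "y = (- \<alpha> (1,1) + \<alpha> (1,2) - \<alpha> (2,1) + \<alpha> (2,2)) / 4"
  define z where "z = (\<alpha> (1,1) - \<alpha> (1,2) - \<alpha> (2,1) + \<alpha> (2,2)) / 4"
  have "\<forall>k. \<alpha> k = t + magic_phase x y z k"
    unfolding forall_2x2 by (simp add: t_def x_def y_def z_def field_simps)
  then have "\<alpha> k = t + magic_phase x y z k" for k by blast
  then have "c k = exp (\<i> * of_real t) * exp (\<i> * of_real (magic_phase x y z k))" for k
    by (simp add: c exp_add [symmetric] distrib_left)
  then have "diag_mat c = cscale (exp (\<i> * of_real t)) (diag_mat (\<lambda>k. exp (\<i> * of_real (magic_phase x y z k))))"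
    by (simp add: vec_eq_iff diag_mat_def)
  then show ?thesis
    by (intro that[of "exp (\<i> * of_real t)" x y z]) (simp_all add: U_d_magic cscale_mult_left cscale_mult_right)
qed

lemma unitary_locally_equiv_U_d:
  assumes U: "unitary_mat U"
  obtains x y z where "locally_equiv U (U_d x y z)"
proof -
  let ?N = "adjoint_mat magic ** U ** magic"
  have "unitary_mat ?N"
    by (intro unitary_mat_mult unitary_mat_adjoint unitary_magic U)
  then obtain e f :: "2 \<times> 2 \<Rightarrow> real ^ (2 \<times> 2)" and d
    where ef: "\<forall>i j. e i \<bullet> e j = (if i = j then 1 else 0)" "\<forall>i j. f i \<bullet> f j = (if i = j then 1 else 0)"
    and N: "\<forall>i. ?N *v cvec (e i) = d i *s cvec (f i)" and d: "\<forall>i. cmod (d i) = 1"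
    by (rule unitary_real_bases)
  obtain V W and s :: "2 \<times> 2 \<Rightarrow> real" where V: "unitary_mat V" "unitary_mat W" and s: "\<forall>k. s k = 1 \<or> s k = -1"
    and e: "\<forall>k. magic *v cvec (e k) = of_real (s k) *s ((V \<otimes>\<^sub>m W) *v (magic *v axis k 1))"
    by (rule real_frame_local [OF ef(1) [rule_format]])
  obtain V' W' and s' :: "2 \<times> 2 \<Rightarrow> real" where V': "unitary_mat V'" "unitary_mat W'" and s': "\<forall>k. s' k = 1 \<or> s' k = -1"
    and f: "\<forall>k. magic *v cvec (f k) = of_real (s' k) *s ((V' \<otimes>\<^sub>m W') *v (magic *v axis k 1))"
    by (rule real_frame_local [OF ef(2) [rule_format]])
  \<comment> \<open>Both frames are local images of the same magic basis; their signs and the phases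
    of \<open>?N\<close> are gathered into one diagonal matrix.\<close>
  define c where "c k = of_real (s k) * d k * of_real (s' k)" for k
  have ss: "of_real (s k) * of_real (s k) = (1 :: complex)" for k
    using s [rule_format, of k] by auto
  have c: "cmod (c k) = 1" for k
    using s [rule_format, of k] s' [rule_format, of k] d [rule_format, of k] by (auto simp: c_def norm_mult)
  have smult: "A *v (r *s v) = r *s (A *v v)" for A :: gate2 and r v
    by (simp add: vec_eq_iff matrix_vector_mult_def sum_distrib_left mult_ac)
  have UV: "U *v ((V \<otimes>\<^sub>m W) *v (magic *v axis k 1)) = c k *s ((V' \<otimes>\<^sub>m W') *v (magic *v axis k 1))" for k
  proof -
    have "(V \<otimes>\<^sub>m W) *v (magic *v axis k 1) = of_real (s k) *s (magic *v cvec (e k))"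
      unfolding e [rule_format] vector_smult_assoc ss by simp
    moreover have "U *v (magic *v cvec (e k)) = d k *s (magic *v cvec (f k))"
    proof -
      have "magic *v (?N *v cvec (e k)) = (magic ** adjoint_mat magic) ** U *v (magic *v cvec (e k))"
        by (simp only: matrix_vector_mul_assoc matrix_mul_assoc)
      then show ?thesis by (simp add: N [rule_format] smult unitary_matD [OF unitary_magic])
    qed
    ultimately show ?thesis
      by (simp add: smult f [rule_format] c_def vector_smult_assoc mult_ac)
  qed
  have "U ** (V \<otimes>\<^sub>m W) ** magic = (V' \<otimes>\<^sub>m W') ** (magic ** diag_mat c)"
  proof -
    have col: "(A *v axis k 1) $ i = A $ i $ k" for A :: gate2 and i k
      by (simp add: matrix_vector_mult_def axis_def if_distrib cong: if_cong)
    have "(U ** (V \<otimes>\<^sub>m W) ** magic) *v axis k 1 = ((V' \<otimes>\<^sub>m W') ** (magic ** diag_mat c)) *v axis k 1" for k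
    proof -
      have "diag_mat c *v axis k 1 = c k *s axis k 1"
        by (simp add: vec_eq_iff col) (simp add: diag_mat_def axis_def)
      then show ?thesis
        using UV[of k] by (simp add: matrix_vector_mul_assoc [symmetric] smult)
    qed
    then show ?thesis by (metis col vec_eq_iff)
  qed
  then have "U ** (V \<otimes>\<^sub>m W) ** magic ** adjoint_mat magic ** adjoint_mat (V \<otimes>\<^sub>m W)
      = (V' \<otimes>\<^sub>m W') ** (magic ** diag_mat c) ** adjoint_mat magic ** adjoint_mat (V \<otimes>\<^sub>m W)"
    by (simp only:)
  moreover have "U ** (V \<otimes>\<^sub>m W) ** magic ** adjoint_mat magic ** adjoint_mat (V \<otimes>\<^sub>m W) = U"
  proof -
    have "U ** (V \<otimes>\<^sub>m W) ** magic ** adjoint_mat magic ** adjoint_mat (V \<otimes>\<^sub>m W)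
      = U ** ((V \<otimes>\<^sub>m W) ** (magic ** adjoint_mat magic) ** adjoint_mat (V \<otimes>\<^sub>m W))"
      by (simp only: matrix_mul_assoc)
    then show ?thesis
      using unitary_mat_kron [OF V] by (simp add: unitary_matD [OF unitary_magic] unitary_matD)
  qed
  moreover obtain w x y z where w: "cmod w = 1"
    "magic ** diag_mat c ** adjoint_mat magic = cscale w (U_d x y z)"
    by (rule magic_diag_phase [OF c])
  ultimately have "U = (V' \<otimes>\<^sub>m W') ** cscale w (U_d x y z) ** (adjoint_mat V \<otimes>\<^sub>m adjoint_mat W)"
    by (simp add: w(2) [symmetric] matrix_mul_assoc adjoint_mat_kron)
  \<comment> \<open>The global phase has no place in \<open>U_d\<close> and is put into a local
    factor.\<close>
  also have "\<dots> = (cscale w V' \<otimes>\<^sub>m W') ** U_d x y z ** (adjoint_mat V \<otimes>\<^sub>m adjoint_mat W)"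
  proof -
    have "cscale w V' \<otimes>\<^sub>m W' = cscale w (V' \<otimes>\<^sub>m W')" by (simp add: vec_eq_iff)
    then show ?thesis by (simp add: cscale_mult_left cscale_mult_right)
  qed
  finally show ?thesis
    using V V' w(1)
    by (intro that[of x y z] locally_equivI) (simp_all add: unitary_mat_cscale unitary_mat_adjoint)
qed

section \<open>Local symmetries of the canonical gates and reduction of the angles\<close>

definition phase_gate :: gate1 where
  "phase_gate = vector [vector [1, 0], vector [0, \<i>]]"

definition sqrt_not :: gate1 where
  "sqrt_not = vector [vector [(1 + \<i>) / 2, (1 - \<i>) / 2], vector [(1 - \<i>) / 2, (1 + \<i>) / 2]]"

lemma unitary_phase_gate: "unitary_mat phase_gate"
  by (simp add: unitary_mat_def phase_gate_def vec2_eq_iff matrix_matrix_mult_def sum_2 mat_def)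

lemma unitary_sqrt_not: "unitary_mat sqrt_not"
  by (simp add: unitary_mat_def sqrt_not_def vec2_eq_iff matrix_matrix_mult_def sum_2 mat_def complex_eq_iff)

text \<open>Conjugation by \<open>phase_gate\<close> exchanges X and Y up to a sign, which occurs on
  both qubits and cancels.\<close>

lemma U_d_swap_12: "locally_equiv (U_d x y z) (U_d y x z)"
proof (rule locally_equivI)
  have "phase_gate ** pauli 0 ** adjoint_mat phase_gate = pauli 0"
    "phase_gate ** pauli 1 ** adjoint_mat phase_gate = pauli 2"
    "phase_gate ** pauli 2 ** adjoint_mat phase_gate = - pauli 1"
    "phase_gate ** pauli 3 ** adjoint_mat phase_gate = pauli 3"
    by (simp_all add: vec2_eq_iff matrix_matrix_mult_def sum_2 phase_gate_def)
  then show "U_d x y z = (phase_gate \<otimes>\<^sub>m phase_gate) ** U_d y x z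
      ** (adjoint_mat phase_gate \<otimes>\<^sub>m adjoint_mat phase_gate)"
    unfolding U_d_pauli_comb local_mult_pauli_comb sum_atMost_3
    by (simp add: vec_eq_iff pauli_comb_nth del: pauli_nth One_nat_def) (simp add: mult_ac)
qed (simp_all add: unitary_phase_gate unitary_mat_adjoint)

lemma U_d_swap_23: "locally_equiv (U_d x y z) (U_d x z y)"
proof (rule locally_equivI)
  have "sqrt_not ** pauli 0 ** adjoint_mat sqrt_not = pauli 0"
    "sqrt_not ** pauli 1 ** adjoint_mat sqrt_not = pauli 1"
    "sqrt_not ** pauli 2 ** adjoint_mat sqrt_not = pauli 3"
    "sqrt_not ** pauli 3 ** adjoint_mat sqrt_not = - pauli 2"
    by (simp_all add: vec2_eq_iff matrix_matrix_mult_def sum_2 sqrt_not_def complex_eq_iff)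
  then show "U_d x y z = (sqrt_not \<otimes>\<^sub>m sqrt_not) ** U_d x z y
      ** (adjoint_mat sqrt_not \<otimes>\<^sub>m adjoint_mat sqrt_not)"
    unfolding U_d_pauli_comb local_mult_pauli_comb sum_atMost_3
    by (simp add: vec_eq_iff pauli_comb_nth del: pauli_nth One_nat_def) (simp add: mult_ac)
qed (simp_all add: unitary_sqrt_not unitary_mat_adjoint)

text \<open>X acts on one qubit only, so the signs from conjugating Y and Z do not cancel; they
  change two angles together.\<close>

lemma U_d_flip_23: "locally_equiv (U_d x y z) (U_d x (- y) (- z))"
proof (rule locally_equivI)
  have "pauli 1 ** pauli 0 ** pauli 1 = pauli 0" "pauli 1 ** pauli 1 ** pauli 1 = pauli 1"
    "pauli 1 ** pauli 2 ** pauli 1 = - pauli 2" "pauli 1 ** pauli 3 ** pauli 1 = - pauli 3"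
    by (simp_all add: vec2_eq_iff matrix_matrix_mult_def sum_2)
  then show "U_d x y z = (pauli 1 \<otimes>\<^sub>m mat 1) ** U_d x (- y) (- z) ** (pauli 1 \<otimes>\<^sub>m mat 1)"
    unfolding U_d_pauli_comb local_mult_pauli_comb sum_atMost_3
    by (simp add: vec_eq_iff pauli_comb_nth del: pauli_nth One_nat_def) (simp add: complex_eq_iff)
qed (simp_all add: unitary_mat_pauli unitary_mat_mat_1)

text \<open>The exponential of i (pi / 2) X\<otimes>X is i X\<otimes>X, which is local.\<close>

lemma U_d_shift_1: "locally_equiv (U_d (x + pi / 2) y z) (U_d x y z)"
proof (rule locally_equivI)
  have "cscale \<i> (pauli 1) ** pauli 0 = cscale \<i> (pauli 1)" "cscale \<i> (pauli 1) ** pauli 1 = cscale \<i> (pauli 0)"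
    "cscale \<i> (pauli 1) ** pauli 2 = cscale (-1) (pauli 3)" "cscale \<i> (pauli 1) ** pauli 3 = pauli 2"
    "pauli 1 ** pauli 0 = pauli 1" "pauli 1 ** pauli 1 = pauli 0"
    "pauli 1 ** pauli 2 = cscale \<i> (pauli 3)" "pauli 1 ** pauli 3 = cscale (- \<i>) (pauli 2)"
    by (simp_all add: vec2_eq_iff matrix_matrix_mult_def sum_2)
  then show "U_d (x + pi / 2) y z = (cscale \<i> (pauli 1) \<otimes>\<^sub>m pauli 1) ** U_d x y z ** (mat 1 \<otimes>\<^sub>m mat 1)"
    unfolding U_d_pauli_comb local_mult_pauli_comb sum_atMost_3
    by (simp add: vec_eq_iff pauli_comb_nth sin_add cos_add del: pauli_nth One_nat_def)
      (simp add: complex_eq_iff algebra_simps)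
qed (simp_all add: unitary_mat_cscale unitary_mat_pauli unitary_mat_mat_1)

lemma U_d_shift_multiple: "locally_equiv (U_d (x + of_int n * (pi / 2)) y z) (U_d x y z)"
proof (induction n rule: int_induct [of _ 0])
  case base
  then show ?case by (simp add: locally_equiv_refl)
next
  case (step1 i)
  have "x + of_int (i + 1) * (pi / 2) = (x + of_int i * (pi / 2)) + pi / 2"
    by (simp add: algebra_simps)
  then show ?case
    using U_d_shift_1 step1(2) by (metis locally_equiv_trans)
next
  case (step2 i)
  have "x + of_int i * (pi / 2) = (x + of_int (i - 1) * (pi / 2)) + pi / 2"
    by (simp add: field_simps)
  then show ?case
    using U_d_shift_1 step2(2) by (metis locally_equiv_trans locally_equiv_sym)
qed

lemma U_d_reduce_1:
  obtains x' where "\<bar>x'\<bar> \<le> pi / 4" "locally_equiv (U_d x y z) (U_d x' y z)"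
proof -
  \<comment> \<open>Subtracting the nearest multiple of pi / 2 leaves at most half a step, which is
    the bound pi / 4.\<close>
  define n where "n = round (x / (pi / 2))"
  have "\<bar>x / (pi / 2) - of_int n\<bar> \<le> 1 / 2"
    using of_int_round_abs_le [of "x / (pi / 2)"] by (simp add: n_def abs_minus_commute)
  then have "\<bar>x / (pi / 2) - of_int n\<bar> * (pi / 2) \<le> 1 / 2 * (pi / 2)"
    by (intro mult_right_mono) auto
  then have "\<bar>(x / (pi / 2) - of_int n) * (pi / 2)\<bar> \<le> pi / 4"
    by (simp add: abs_mult)
  moreover have "(x / (pi / 2) - of_int n) * (pi / 2) = x - of_int n * (pi / 2)"
    by (simp add: field_simps)
  ultimately have "\<bar>x - of_int n * (pi / 2)\<bar> \<le> pi / 4" by (simp only:)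
  moreover have "locally_equiv (U_d x y z) (U_d (x - of_int n * (pi / 2)) y z)"
    using U_d_shift_multiple [of "x - of_int n * (pi / 2)" n] by simp
  ultimately show ?thesis by (rule that)
qed

lemma U_d_reduce:
  obtains x' y' z' where "\<bar>x'\<bar> \<le> pi / 4" "\<bar>y'\<bar> \<le> pi / 4" "\<bar>z'\<bar> \<le> pi / 4"
    "locally_equiv (U_d x y z) (U_d x' y' z')"
proof -
  obtain x' where x': "\<bar>x'\<bar> \<le> pi / 4" "locally_equiv (U_d x y z) (U_d x' y z)"
    by (rule U_d_reduce_1)
  obtain y' where y': "\<bar>y'\<bar> \<le> pi / 4" "locally_equiv (U_d y x' z) (U_d y' x' z)"
    by (rule U_d_reduce_1)
  obtain z' where z': "\<bar>z'\<bar> \<le> pi / 4" "locally_equiv (U_d z y' x') (U_d z' y' x')"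
    by (rule U_d_reduce_1)
  note [trans] = locally_equiv_trans
  note x'(2)
  also have "locally_equiv (U_d x' y z) (U_d y x' z)" by (rule U_d_swap_12)
  also note y'(2)
  also have "locally_equiv (U_d y' x' z) (U_d y' z x')" by (rule U_d_swap_23)
  also have "locally_equiv (U_d y' z x') (U_d z y' x')" by (rule U_d_swap_12)
  also note z'(2)
  finally show ?thesis using x'(1) y'(1) z'(1) by (intro that)
qed

lemma U_d_sort:
  assumes "\<bar>x\<bar> \<le> c" "\<bar>y\<bar> \<le> c" "\<bar>z\<bar> \<le> c"
  obtains x' y' z' where "\<bar>z'\<bar> \<le> \<bar>y'\<bar>" "\<bar>y'\<bar> \<le> \<bar>x'\<bar>" "\<bar>x'\<bar> \<le> c"
    "locally_equiv (U_d x y z) (U_d x' y' z')"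
proof -
  \<comment> \<open>Insertion of the third angle into a pair already ordered by absolute
    value.\<close>
  have "\<exists>y' z' x'. \<bar>z'\<bar> \<le> \<bar>y'\<bar> \<and> \<bar>y'\<bar> \<le> \<bar>x'\<bar> \<and> \<bar>x'\<bar> \<le> c \<and> locally_equiv (U_d a b d) (U_d x' y' z')"
    if *: "\<bar>a\<bar> \<le> c" "\<bar>b\<bar> \<le> c" "\<bar>b\<bar> \<le> \<bar>a\<bar>" "\<bar>d\<bar> \<le> c" for a b d
  proof -
    have 1: "locally_equiv (U_d a b d) (U_d a d b)" by (rule U_d_swap_23)
    have 2: "locally_equiv (U_d a b d) (U_d d a b)"
      by (rule locally_equiv_trans [OF 1 U_d_swap_12])
    consider "\<bar>d\<bar> \<le> \<bar>b\<bar>" | "\<bar>b\<bar> \<le> \<bar>d\<bar>" "\<bar>d\<bar> \<le> \<bar>a\<bar>" | "\<bar>a\<bar> \<le> \<bar>d\<bar>" by linarith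
    then show ?thesis
      using * 1 2 locally_equiv_refl by cases blast+
  qed
  note sort = this
  show ?thesis
  proof (cases "\<bar>y\<bar> \<le> \<bar>x\<bar>")
    case True
    with sort [of x y z] assms that show ?thesis by blast
  next
    case False
    with sort [of y x z] assms obtain x' y' z'
      where le: "\<bar>z'\<bar> \<le> \<bar>y'\<bar>" "\<bar>y'\<bar> \<le> \<bar>x'\<bar>" "\<bar>x'\<bar> \<le> c"
      and eq: "locally_equiv (U_d y x z) (U_d x' y' z')" by auto
    show ?thesis
      by (rule that [OF le locally_equiv_trans [OF U_d_swap_12 eq]])
  qed
qed

lemma U_d_flip_13: "locally_equiv (U_d x y z) (U_d (- x) y (- z))"
  by (rule locally_equiv_trans [OF U_d_swap_12 locally_equiv_trans [OF U_d_flip_23 U_d_swap_12]])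

text \<open>Each sign removed from the first or second angle is passed on to the third, so only the
  absolute value of the latter is controlled.\<close>

lemma U_d_fix_signs:
  obtains s where "\<bar>s\<bar> = \<bar>z\<bar>" "locally_equiv (U_d x y z) (U_d \<bar>x\<bar> \<bar>y\<bar> s)"
proof -
  have *: "\<exists>s. \<bar>s\<bar> = \<bar>z\<bar> \<and> locally_equiv (U_d x y z) (U_d \<bar>x\<bar> y s)" for z
    using U_d_flip_13 [of x y z] locally_equiv_refl [of "U_d x y z"]
    by (cases "x \<ge> 0") (auto intro: exI[of _ z] exI[of _ "- z"])
  obtain t where t: "\<bar>t\<bar> = \<bar>z\<bar>" "locally_equiv (U_d x y z) (U_d \<bar>x\<bar> y t)"
    using * by blast
  show ?thesis
  proof (cases "y \<ge> 0")
    case True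
    with t that [of t] show ?thesis by simp
  next
    case False
    with t that [of "- t"] locally_equiv_trans [OF t(2) U_d_flip_23] show ?thesis by simp
  qed
qed

lemma cartan_form_exists:
  assumes "unitary_mat U"
  obtains x y z where "cartan_form U x y z"
proof -
  obtain x1 y1 z1 where 1: "locally_equiv U (U_d x1 y1 z1)"
    using assms by (rule unitary_locally_equiv_U_d)
  obtain x2 y2 z2 where 2: "\<bar>x2\<bar> \<le> pi / 4" "\<bar>y2\<bar> \<le> pi / 4" "\<bar>z2\<bar> \<le> pi / 4"
    "locally_equiv (U_d x1 y1 z1) (U_d x2 y2 z2)"
    by (rule U_d_reduce)
  obtain x3 y3 z3 where 3: "\<bar>z3\<bar> \<le> \<bar>y3\<bar>" "\<bar>y3\<bar> \<le> \<bar>x3\<bar>" "\<bar>x3\<bar> \<le> pi / 4"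
    "locally_equiv (U_d x2 y2 z2) (U_d x3 y3 z3)"
    using 2(1-3) by (rule U_d_sort)
  obtain s where s: "\<bar>s\<bar> = \<bar>z3\<bar>" "locally_equiv (U_d x3 y3 z3) (U_d \<bar>x3\<bar> \<bar>y3\<bar> s)"
    by (rule U_d_fix_signs)
  have "locally_equiv U (U_d \<bar>x3\<bar> \<bar>y3\<bar> s)"
    by (rule locally_equiv_trans [OF locally_equiv_trans [OF 1 2(4)] locally_equiv_trans [OF 3(4) s(2)]])
  with 3 s(1) show ?thesis
    by (intro that[of "\<bar>x3\<bar>" "\<bar>y3\<bar>" s]) (simp add: cartan_form_iff)
qed

theorem theorem3:
  shows "(\<forall>U. unitary_mat U \<longrightarrow>
            C_max U \<in> {0..1} \<and> 1 + 2 * C_max U \<le> \<gamma> U \<and> \<gamma> U \<le> 7) \<and>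
         attains (\<lambda>\<theta>. U_d \<theta> 0 0) (\<lambda>v. 1 + 2 * v) \<and>
         attains (\<lambda>\<theta>. U_d (pi / 4) (pi / 4) \<theta>) (\<lambda>v. 7)"
proof (intro conjI allI impI)
  fix U :: gate2 assume U: "unitary_mat U"
  obtain x y z where c: "cartan_form U x y z"
    using U by (rule cartan_form_exists)
  show "C_max U \<in> {0..1}" using C_max_bounds [OF U] by simp
  show "1 + 2 * C_max U \<le> \<gamma> U" using U c by (rule C_max_le_extent)
  show "\<gamma> U \<le> 7" using c by (rule extent_le_7)
qed (rule attains_controlled attains_iSWAP_SWAP)+

end
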